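(* Let $T$ be a finite subset of $\mathbb{R}^d$ with $|T|\ge 3$, let $\mathcal{F}$ be a countable family of $2d$-variate real polynomials that respects $T$, and let $g$ and $k$ be positive integers. Then there exist a finite set $X\subset\mathbb{R}^d$ and a collection $\mathcal{T}$ of homothetic copies of $T$ contained in $X$ such that: (1) $\mathcal{F}$ respects $X$; (2) no tuple of fewer than $g$ members of $\mathcal{T}$ forms a cycle (on $X$); (3) for every coloring of $X$ with $k$ colors, some member of $\mathcal{T}$ is monochromatic.
   Context: A homothetic map in $\mathbb{R}^d$ is a map $h:\mathbb{R}^d\to\mathbb{R}^d$ of the form $h(p)=p^*+\lambda p$ for some $p^*\in\mathbb{R}^d$ and $\lambda>0$; a set $T'$ is a homothetic copy of $T$ if $T'=h(T)$ for some homothetic map $h$. A family $\mathcal{F}$ of $2d$-variate real polynomials respects a set $X\subset\mathbb{R}^d$ if $f(p,q)\neq 0$ for all $f\in\mathcal{F}$ and all pairs of distinct points $p,q\in X$. A cycle of length $\ell\ge 2$ on a set $X$ is a tuple $(T_1,\dots,T_\ell)$ of distinct subsets of $X$ such that there exist distinct elements $x_1,\dots,x_\ell\in X$ with $x_i\in T_i\cap T_{i+1}$ for $i\in[\ell-1]$ and $x_\ell\in T_\ell\cap T_1$. *)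

theory Defs
  imports "HOL-Analysis.Analysis" "HOL-Library.Poly_Mapping"
begin

definition homothetic_map :: "(real ^ 'd \<Rightarrow> real ^ 'd) \<Rightarrow> bool" where
  "homothetic_map h \<longleftrightarrow> (\<exists>v l. l > 0 \<and> h = (\<lambda>p. v + l *\<^sub>R p))"

definition homothetic_copy :: "(real ^ 'd) set \<Rightarrow> (real ^ 'd) set \<Rightarrow> bool" where
  "homothetic_copy T T' \<longleftrightarrow> (\<exists>h. homothetic_map h \<and> T' = h ` T)"

text \<open>
  Polynomials in the variables \<^typ>\<open>'v\<close> are finitely supported maps from monomials
  (themselves finitely supported exponent maps) to coefficients. For a polynomial in \<open>2d\<close>
  variables the variable type is \<^typ>\<open>'d + 'd\<close>, where \<open>Inl i\<close> stands for the
  \<open>i\<close>-th coordinate of the first point and \<open>Inr i\<close> for that of the second.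
\<close>

type_synonym 'v real_mpoly = "('v \<Rightarrow>\<^sub>0 nat) \<Rightarrow>\<^sub>0 real"

definition eval_mpoly :: "('v::finite) real_mpoly \<Rightarrow> ('v \<Rightarrow> real) \<Rightarrow> real" where
  "eval_mpoly f x =
     (\<Sum>m\<in>Poly_Mapping.keys f. Poly_Mapping.lookup f m *
        (\<Prod>v\<in>UNIV. x v ^ Poly_Mapping.lookup m v))"

definition eval_pair :: "('d + 'd) real_mpoly \<Rightarrow> real ^ ('d::finite) \<Rightarrow> real ^ 'd \<Rightarrow> real" where
  "eval_pair f p q = eval_mpoly f (case_sum (($) p) (($) q))"

definition respects_set :: "('d + 'd) real_mpoly set \<Rightarrow> (real ^ ('d::finite)) set \<Rightarrow> bool" where
  "respects_set F X \<longleftrightarrow> (\<forall>f\<in>F. \<forall>p\<in>X. \<forall>q\<in>X. p \<noteq> q \<longrightarrow> eval_pair f p q \<noteq> 0)"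

definition cycle_on :: "'a set \<Rightarrow> 'a set list \<Rightarrow> bool" where
  "cycle_on X Ts \<longleftrightarrow>
     length Ts \<ge> 2 \<and> distinct Ts \<and> (\<forall>S\<in>set Ts. S \<subseteq> X) \<and>
     (\<exists>xs. length xs = length Ts \<and> distinct xs \<and> set xs \<subseteq> X \<and>
        (\<forall>i. Suc i < length Ts \<longrightarrow> xs ! i \<in> Ts ! i \<inter> Ts ! Suc i) \<and>
        last xs \<in> last Ts \<inter> hd Ts)"

definition monochromatic :: "('a \<Rightarrow> 'c) \<Rightarrow> 'a set \<Rightarrow> bool" where
  "monochromatic c S \<longleftrightarrow> (\<exists>a. \<forall>x\<in>S. c x = a)"

end

theory Submission
  imports Defs
begin

text \<open>
  Points of a cube over the alphabet \<open>T\<close> are placed in space by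
  \<open>(t\<^sub>1, \<dots>, t\<^sub>n) \<mapsto> \<Sum>i. l\<^sub>i t\<^sub>i\<close> with \<open>l\<^sub>i > 0\<close>, which sends
  combinatorial lines to homothetic copies of \<open>T\<close>. For points \<open>p \<noteq> q\<close> of the cube and
  \<open>f \<in> F\<close>, the value of \<open>f\<close> at their images is a polynomial in \<open>l\<close> that is nonzero at the
  unit vector of a coordinate in which \<open>p\<close> and \<open>q\<close> differ, because \<open>F\<close> respects \<open>T\<close>; so a
  generic \<open>l\<close> makes all these countably many polynomials nonzero. It remains to find a family
  of lines without short cycles that is not \<open>k\<close>-colourable. Starting from the Hales--Jewett
  theorem, this is done by the partite amalgamation of Nesetril and Rodl, which raises the girth
  while using systems of smaller girth over larger alphabets. Of the cube, amalgamation
  retains the coordinate functions: maps to the alphabet that are the identity or constant on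
  each line and that together separate points.
\<close>

subsection \<open>The Hales--Jewett theorem\<close>

text \<open>Combinatorial lines are encoded as words over \<open>'a option\<close>:
  \<open>None\<close> marks the moving positions and \<open>Some b\<close> the fixed ones, so that
  \<open>fill w\<close> runs through the line.\<close>

definition fill :: "'a option list \<Rightarrow> 'a \<Rightarrow> 'a list" where
  "fill w a = map (case_option a id) w"

definition template :: "'a set \<Rightarrow> nat \<Rightarrow> 'a option list \<Rightarrow> bool" where
  "template A n w \<longleftrightarrow> length w = n \<and> None \<in> set w \<and> set w \<subseteq> insert None (Some ` A)"

definition words :: "'a set \<Rightarrow> nat \<Rightarrow> 'a list set" where
  "words A n = {u. set u \<subseteq> A \<and> length u = n}"

lemma fill_append: "fill (v @ w) a = fill v a @ fill w a"
  by (simp add: fill_def)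

lemma fill_Some: "fill (map Some u) a = u"
  by (simp add: fill_def map_idI)

lemma finite_words: "finite A \<Longrightarrow> finite (words A n)"
  unfolding words_def by (rule finite_lists_length_eq)

lemma fill_in_words: "template A n w \<Longrightarrow> a \<in> A \<Longrightarrow> fill w a \<in> words A n"
  by (force simp: template_def words_def fill_def)

lemma words_append: "u \<in> words A m \<Longrightarrow> v \<in> words A n \<Longrightarrow> u @ v \<in> words A (m + n)"
  by (auto simp: words_def)

lemma template_append: "template A m v \<Longrightarrow> template A n w \<Longrightarrow> template A (m + n) (v @ w)"
  by (auto simp: template_def)

lemma template_append_word: "template A m v \<Longrightarrow> u \<in> words A n \<Longrightarrow> template A (m + n) (v @ map Some u)"
  by (auto simp: template_def words_def)

lemma template_word_append: "u \<in> words A m \<Longrightarrow> template A n w \<Longrightarrow> template A (m + n) (map Some u @ w)"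
  by (auto simp: template_def words_def)

lemma template_mono: "template A n w \<Longrightarrow> A \<subseteq> B \<Longrightarrow> template B n w"
  unfolding template_def by blast

definition mono_line :: "'a set \<Rightarrow> nat \<Rightarrow> ('a list \<Rightarrow> 'c) \<Rightarrow> bool" where
  "mono_line A n c \<longleftrightarrow> (\<exists>w q. template A n w \<and> (\<forall>a\<in>A. c (fill w a) = q))"

definition HJ :: "'a set \<Rightarrow> nat \<Rightarrow> nat \<Rightarrow> bool" where
  "HJ A k n \<longleftrightarrow> (\<forall>c. c ` words A n \<subseteq> {..<k} \<longrightarrow> mono_line A n c)"

text \<open>Numbering the palette \<open>K\<close> reduces this to the colours below
  \<open>card K\<close>. Colour focusing uses it with functions as colours.\<close>

lemma HJ_finite_colours:
  fixes c :: "'a list \<Rightarrow> 'c"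
  assumes "HJ A (card K) n" "finite K" "c ` words A n \<subseteq> K"
  shows "mono_line A n c"
proof -
  obtain h where h: "bij_betw h K {0..<card K}"
    using ex_bij_betw_finite_nat[OF assms(2)] by blast
  have "(h \<circ> c) ` words A n \<subseteq> {..<card K}"
    using assms(3) h by (fastforce simp: bij_betw_def)
  then obtain w q where w: "template A n w" "\<forall>a\<in>A. h (c (fill w a)) = q"
    using assms(1) unfolding HJ_def mono_line_def by fastforce
  have "c (fill w a) = c (fill w b)" if "a \<in> A" "b \<in> A" for a b
    using that w assms(3) fill_in_words[OF w(1)] h
    by (metis bij_betw_def image_subset_iff inj_onD)
  then show ?thesis
    unfolding mono_line_def using w(1) by (metis)
qed

definition focused :: "'a set \<Rightarrow> 'a \<Rightarrow> nat \<Rightarrow> ('a list \<Rightarrow> nat) \<Rightarrow> 'a list \<Rightarrow> nat set \<Rightarrow> bool" where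
  "focused A b n c f Q \<longleftrightarrow> f \<in> words (insert b A) n \<and> finite Q \<and>
     (\<forall>q\<in>Q. \<exists>w. template (insert b A) n w \<and> fill w b = f \<and> (\<forall>a\<in>A. c (fill w a) = q))"

text \<open>Colour focusing: a point at which lines of ever more colours, each monochromatic
  off the new letter \<open>b\<close>, meet in their \<open>b\<close>-th point.\<close>

lemma HJ_focusing:
  assumes "finite A" "A \<noteq> {}" and HJ: "\<And>k. \<exists>n. HJ A k n"
  shows "\<exists>n. \<forall>c. c ` words (insert b A) n \<subseteq> {..<k} \<longrightarrow>
    mono_line (insert b A) n c \<or> (\<exists>f Q. focused A b n c f Q \<and> card Q = r)"
proof (induction r)
  case 0
  have "focused A b 0 c [] {}" for c
    by (simp add: focused_def words_def)
  then show ?case by (metis card.empty)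
next
  case (Suc r)
  let ?B = "insert b A"
  obtain m where m: "\<And>c. c ` words ?B m \<subseteq> {..<k} \<Longrightarrow>
    mono_line ?B m c \<or> (\<exists>f Q. focused A b m c f Q \<and> card Q = r)"
    using Suc by blast
  \<comment> \<open>A tail of length \<open>n\<close> will be coloured by the whole colouring it
    induces on the heads in \<open>words ?B m\<close>. This palette is finite, and \<open>m\<close>
    is fixed before \<open>n\<close>.\<close>
  define K where "K = (words ?B m \<rightarrow>\<^sub>E {..<k})"
  have finK: "finite K"
    unfolding K_def using assms(1) by (intro finite_PiE finite_words) auto
  obtain n where n: "HJ A (card K) n" using HJ by blast
  obtain a0 where a0: "a0 \<in> A" using assms(2) by blast
  have "mono_line ?B (m + n) c \<or> (\<exists>f Q. focused A b (m + n) c f Q \<and> card Q = Suc r)"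
    if c: "c ` words ?B (m + n) \<subseteq> {..<k}" for c
  proof -
    define d where "d v = (\<lambda>u\<in>words ?B m. c (u @ v))" for v
    have sub: "words A n \<subseteq> words ?B n" by (auto simp: words_def)
    have "d ` words A n \<subseteq> K"
      using c sub words_append[of _ ?B m _ n] by (fastforce simp: d_def K_def)
    from HJ_finite_colours[OF n finK this]
    obtain w q where w: "template A n w" and "\<forall>a\<in>A. d (fill w a) = q"
      unfolding mono_line_def by blast
    then have d_const: "d (fill w a) u = d (fill w a0) u" if "a \<in> A" for a u
      using that a0 by simp
    then have const: "c (u @ fill w a) = c (u @ fill w a0)" if "a \<in> A" "u \<in> words ?B m" for a u
      using d_const[OF that(1), of u] that(2) by (simp add: d_def)
    \<comment> \<open>Along the tail line \<open>w\<close> the induced colouring of the heads is the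
      same for every letter of \<open>A\<close>; \<open>c'\<close> is this common colouring. Nothing
      is known about the tail \<open>fill w b\<close>.\<close>
    define c' where "c' u = c (u @ fill w a0)" for u
    have wB: "template ?B n w" using w by (rule template_mono) auto
    have w0: "fill w a0 \<in> words ?B n" using fill_in_words[OF wB] a0 by simp
    have lift: "mono_line ?B (m + n) c" if mono: "mono_line ?B m c'"
    proof -
      obtain v q where v: "template ?B m v" "\<forall>a\<in>?B. c' (fill v a) = q"
        using mono unfolding mono_line_def by blast
      then show ?thesis
        unfolding mono_line_def
        using template_append_word[OF v(1) w0]
        by (intro exI[of _ "v @ map Some (fill w a0)"] exI[of _ q])
          (simp add: fill_append fill_Some c'_def)
    qed
    have "c' ` words ?B m \<subseteq> {..<k}"
      using c words_append[OF _ w0] by (auto simp: c'_def)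
    from m[OF this] consider "mono_line ?B m c'"
      | f Q where "focused A b m c' f Q" "card Q = r" by blast
    then show ?thesis
    proof cases
      case 1
      then show ?thesis using lift by blast
    next
      case (2 f Q)
      have f: "f \<in> words ?B m" and finQ: "finite Q" using 2 by (auto simp: focused_def)
      have foc: "\<exists>v. template ?B m v \<and> fill v b = f \<and> (\<forall>a\<in>A. c' (fill v a) = q)" if "q \<in> Q" for q
        using 2 that by (auto simp: focused_def)
      show ?thesis
      proof (cases "c' f \<in> Q")
        case True
        then have "mono_line ?B m c'"
          using foc[OF True] unfolding mono_line_def by (metis insert_iff)
        then show ?thesis using lift by blast
      next
        case False
        \<comment> \<open>The new focus is \<open>f @ fill w b\<close>. The old lines now move in
          both blocks, as \<open>v @ w\<close>, and keep their colours; holding the head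
          \<open>f\<close> fixed yields one further line, whose colour \<open>c' f\<close> is not in
          \<open>Q\<close>.\<close>
        have "\<exists>v. template ?B (m + n) v \<and> fill v b = f @ fill w b \<and> (\<forall>a\<in>A. c (fill v a) = q)"
          if q: "q \<in> insert (c' f) Q" for q
        proof (cases "q = c' f")
          case True
          then show ?thesis
            using template_word_append[OF f wB] const f
            by (intro exI[of _ "map Some f @ w"]) (simp add: fill_append fill_Some c'_def)
        next
          case False
          then obtain v where v: "template ?B m v" "fill v b = f" "\<forall>a\<in>A. c' (fill v a) = q"
            using foc q by blast
          have "c (fill (v @ w) a) = q" if "a \<in> A" for a
            using that v const[OF that fill_in_words[OF v(1), of a]] by (simp add: fill_append c'_def)
          then show ?thesis
            using template_append[OF v(1) wB] v by (metis fill_append)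
        qed
        then have "focused A b (m + n) c (f @ fill w b) (insert (c' f) Q)"
          using finQ words_append[OF f fill_in_words[OF wB, of b]] by (simp add: focused_def)
        moreover have "card (insert (c' f) Q) = Suc r" using False finQ 2 by simp
        ultimately show ?thesis by blast
      qed
    qed
  qed
  then show ?case by blast
qed

text \<open>Induction on the alphabet. Focused lines in \<open>Suc k\<close> different colours
  cannot exist when there are only \<open>k\<close> colours, so focusing must produce a
  monochromatic line. The one-letter alphabet is treated apart because focusing starts from a
  nonempty \<open>A\<close>.\<close>

theorem Hales_Jewett:
  assumes "finite A" shows "\<exists>n. HJ A k n"
  using assms
proof (induction A arbitrary: k rule: finite_induct)
  case empty
  have "template {} 1 [None]" by (simp add: template_def)
  then show ?case unfolding HJ_def mono_line_def by blast
next
  case (insert b A)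
  show ?case
  proof (cases "A = {}")
    case True
    have "template {b} 1 [None]" by (simp add: template_def)
    then show ?thesis unfolding HJ_def mono_line_def True by blast
  next
    case False
    then obtain a where a: "a \<in> A" by blast
    obtain n where n: "\<And>c. c ` words (insert b A) n \<subseteq> {..<k} \<Longrightarrow>
      mono_line (insert b A) n c \<or> (\<exists>f Q. focused A b n c f Q \<and> card Q = Suc k)"
      using HJ_focusing[OF insert.hyps(1) False insert.IH, of b k "Suc k"] by blast
    have "mono_line (insert b A) n c" if c: "c ` words (insert b A) n \<subseteq> {..<k}" for c
    proof (rule ccontr)
      assume "\<not> ?thesis"
      then obtain f Q where Q: "focused A b n c f Q" "card Q = Suc k" using n[OF c] by blast
      have "Q \<subseteq> {..<k}"
      proof
        fix q assume "q \<in> Q"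
        then obtain w where "template (insert b A) n w" "c (fill w a) = q"
          using Q a unfolding focused_def by blast
        then show "q \<in> {..<k}" using c fill_in_words[of "insert b A" n w a] a by auto
      qed
      from card_mono[OF _ this] Q(2) show False by simp
    qed
    then show ?thesis unfolding HJ_def by blast
  qed
qed

subsection \<open>Sparse families of sets\<close>

text \<open>The hypergraph analogue of a pendant edge. Members are indexed, so a set of at least two
  points that occurs under two indices of \<open>S\<close> makes neither of them a leaf.\<close>

definition leaf :: "('i \<Rightarrow> 'v set) \<Rightarrow> 'i set \<Rightarrow> 'i \<Rightarrow> bool" where
  "leaf N S i \<longleftrightarrow> (\<forall>u v. u \<in> N i \<and> v \<in> N i \<and>
     u \<in> (\<Union>j\<in>S - {i}. N j) \<and> v \<in> (\<Union>j\<in>S - {i}. N j) \<longrightarrow> u = v)"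

text \<open>Every cycle of length at least two is a subfamily without a leaf, and this notion is
  easier to carry through amalgamations than the absence of cycles.\<close>

definition sparse :: "nat \<Rightarrow> ('i \<Rightarrow> 'v set) \<Rightarrow> 'i set \<Rightarrow> bool" where
  "sparse g N I \<longleftrightarrow>
     (\<forall>S. S \<subseteq> I \<and> finite S \<and> S \<noteq> {} \<and> card S < g \<longrightarrow> (\<exists>i\<in>S. leaf N S i))"

text \<open>Choosing one preimage under \<open>h\<close> for each member of a subfamily gives a
  subfamily of \<open>I\<close> of the same size; its leaf is carried over because \<open>q\<close>
  is injective on all the sets involved.\<close>

lemma sparse_image:
  assumes "sparse g N I" "inj_on q V" "\<And>i. i \<in> I \<Longrightarrow> N i \<subseteq> V"
    and "J \<subseteq> h ` I" "\<And>i. i \<in> I \<Longrightarrow> N' (h i) = q ` N i"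
  shows "sparse g N' J"
  unfolding sparse_def
proof (intro allI impI)
  fix S assume S: "S \<subseteq> J \<and> finite S \<and> S \<noteq> {} \<and> card S < g"
  define r where "r = inv_into I h"
  have r: "r j \<in> I" "h (r j) = j" if "j \<in> S" for j
    using that S assms(4) by (auto simp: r_def inv_into_into f_inv_into_f subset_iff)
  have inj: "inj_on r S" using r by (metis inj_onI)
  have "r ` S \<subseteq> I \<and> finite (r ` S) \<and> r ` S \<noteq> {} \<and> card (r ` S) < g"
    using r S card_image[OF inj] by auto
  then obtain j where j: "j \<in> S" "leaf N (r ` S) (r j)"
    using assms(1) unfolding sparse_def by blast
  have N': "N' i = q ` N (r i)" if "i \<in> S" for i using assms(5) r that by metis
  have "leaf N' S j"
    unfolding leaf_def
  proof (intro allI impI)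
    fix u v assume uv: "u \<in> N' j \<and> v \<in> N' j \<and> u \<in> (\<Union>i\<in>S - {j}. N' i) \<and> v \<in> (\<Union>i\<in>S - {j}. N' i)"
    have pull: "\<exists>x. x \<in> N (r j) \<and> x \<in> (\<Union>i\<in>r ` S - {r j}. N i) \<and> w = q x"
      if w: "w \<in> N' j" "w \<in> (\<Union>i\<in>S - {j}. N' i)" for w
    proof -
      obtain i where i: "i \<in> S" "i \<noteq> j" "w \<in> N' i" using w by blast
      obtain x y where xy: "x \<in> N (r j)" "y \<in> N (r i)" "w = q x" "w = q y"
        using w(1) i N'[OF i(1)] N'[OF j(1)] by blast
      have "x \<in> V" "y \<in> V" using assms(3) r(1)[OF i(1)] r(1)[OF j(1)] xy by blast+
      then have "x = y" using assms(2) xy by (auto dest: inj_onD)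
      moreover have "r i \<noteq> r j" using inj i j by (auto dest: inj_onD)
      ultimately show ?thesis using xy i by blast
    qed
    from uv pull[of u] pull[of v] j(2) show "u = v" unfolding leaf_def by blast
  qed
  then show "\<exists>i\<in>S. leaf N' S i" using j by blast
qed

text \<open>If a leaf is lost because it contains the extra point \<open>w\<close>, it is removed and the point at
  which it was attached takes the role of \<open>w\<close>.\<close>

lemma sparse_pointed_leaf:
  assumes "sparse g N I" "S \<subseteq> I" "finite S" "S \<noteq> {}" "card S < g"
  shows "\<exists>i\<in>S. \<forall>u v. u \<in> N i \<and> v \<in> N i \<and>
    (u = w \<or> u \<in> (\<Union>j\<in>S - {i}. N j)) \<and> (v = w \<or> v \<in> (\<Union>j\<in>S - {i}. N j)) \<longrightarrow> u = v"
  using assms(2-5)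
proof (induction "card S" arbitrary: S w rule: less_induct)
  case less
  obtain i where i: "i \<in> S" "leaf N S i"
    using assms(1) less.prems unfolding sparse_def by blast
  show ?case
  proof (cases "\<exists>p. p \<in> N i \<and> p \<noteq> w \<and> w \<in> N i \<and> w \<notin> (\<Union>j\<in>S - {i}. N j) \<and> p \<in> (\<Union>j\<in>S - {i}. N j)")
    case False
    then show ?thesis using i unfolding leaf_def by (intro bexI[of _ i]) metis+
  next
    case True
    then obtain p where p: "p \<in> N i" "p \<noteq> w" "w \<in> N i" "w \<notin> (\<Union>j\<in>S - {i}. N j)"
      "p \<in> (\<Union>j\<in>S - {i}. N j)" by blast
    have "card (S - {i}) < card S" using i less.prems(2) by (metis card_Diff1_less)
    moreover have "S - {i} \<noteq> {}" using p(5) by auto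
    ultimately obtain l where l: "l \<in> S - {i}" and l2: "\<And>u v. u \<in> N l \<and> v \<in> N l \<and>
      (u = p \<or> u \<in> (\<Union>j\<in>S - {i} - {l}. N j)) \<and> (v = p \<or> v \<in> (\<Union>j\<in>S - {i} - {l}. N j)) \<Longrightarrow> u = v"
      using less.hyps[of "S - {i}" p] less.prems by auto
    \<comment> \<open>A point of \<open>N l\<close> that also lies in \<open>N i\<close> is an
      attachment point of the leaf \<open>i\<close> and so equals \<open>p\<close>; outside
      \<open>N i\<close> the point \<open>w\<close> cannot occur.\<close>
    have red: "u = p \<or> u \<in> (\<Union>j\<in>S - {i} - {l}. N j)"
      if "u \<in> N l" "u = w \<or> u \<in> (\<Union>j\<in>S - {l}. N j)" for u
    proof (cases "u \<in> N i")
      case True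
      then have "u = p" using i(2) p l that unfolding leaf_def by blast
      then show ?thesis ..
    next
      case False
      then show ?thesis using that p(3) by blast
    qed
    show ?thesis
    proof (intro bexI[of _ l] allI impI)
      fix u v assume "u \<in> N l \<and> v \<in> N l \<and>
        (u = w \<or> u \<in> (\<Union>j\<in>S - {l}. N j)) \<and> (v = w \<or> v \<in> (\<Union>j\<in>S - {l}. N j))"
      then show "u = v" using l2[of u v] red[of u] red[of v] by blast
    qed (use l in auto)
  qed
qed

subsection \<open>Line systems\<close>

definition coordinate :: "'a set \<Rightarrow> 'v set \<Rightarrow> ('a \<Rightarrow> 'v) set \<Rightarrow> ('v \<Rightarrow> 'a) \<Rightarrow> bool" where
  "coordinate A V E \<phi> \<longleftrightarrow> \<phi> ` V \<subseteq> A \<and>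
     (\<forall>e\<in>E. (\<forall>a\<in>A. \<phi> (e a) = a) \<or> (\<exists>b. \<forall>a\<in>A. \<phi> (e a) = b))"

text \<open>An abstraction of a set of combinatorial lines in a cube over the alphabet \<open>A\<close>:
  the coordinate functions of the cube are recovered as the maps \<open>\<phi>\<close>.\<close>

definition line_system :: "'a set \<Rightarrow> 'v set \<Rightarrow> ('a \<Rightarrow> 'v) set \<Rightarrow> bool" where
  "line_system A V E \<longleftrightarrow> finite V \<and> E \<subseteq> A \<rightarrow>\<^sub>E V \<and> (\<forall>e\<in>E. inj_on e A) \<and>
     (\<forall>x\<in>V. \<forall>y\<in>V. x \<noteq> y \<longrightarrow> (\<exists>\<phi>. coordinate A V E \<phi> \<and> \<phi> x \<noteq> \<phi> y))"

text \<open>The set \<open>J\<close> collects the parts (fibres of \<open>\<pi>\<close>) over which amalgamation has already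
  taken place; on every other part a colouring is still required to be constant.\<close>

definition partite_system ::
  "'a set \<Rightarrow> nat \<Rightarrow> nat \<Rightarrow> ('v \<Rightarrow> 'x) \<Rightarrow> 'x set \<Rightarrow> 'v set \<Rightarrow> ('a \<Rightarrow> 'v) set \<Rightarrow> bool" where
  "partite_system A k g \<pi> J V E \<longleftrightarrow> line_system A V E \<and> sparse g (\<lambda>e. e ` A) E \<and>
     (\<forall>e\<in>E. inj_on (\<pi> \<circ> e) A) \<and>
     (\<forall>c. c ` V \<subseteq> {..<k} \<and> (\<forall>x\<in>V. \<forall>y\<in>V. \<pi> x = \<pi> y \<and> \<pi> x \<notin> J \<longrightarrow> c x = c y) \<longrightarrow>
        (\<exists>e\<in>E. \<exists>q. \<forall>a\<in>A. c (e a) = (q::nat)))"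

lemma partite_systemI:
  assumes "line_system A V E" "sparse g (\<lambda>e. e ` A) E" "\<And>e. e \<in> E \<Longrightarrow> inj_on (\<pi> \<circ> e) A"
    and "\<And>c :: 'v \<Rightarrow> nat. c ` V \<subseteq> {..<k} \<Longrightarrow>
      (\<And>x y. x \<in> V \<Longrightarrow> y \<in> V \<Longrightarrow> \<pi> x = \<pi> y \<Longrightarrow> \<pi> x \<notin> J \<Longrightarrow> c x = c y) \<Longrightarrow>
      \<exists>e\<in>E. \<exists>q. \<forall>a\<in>A. c (e a) = q"
  shows "partite_system A k g \<pi> J V E"
  unfolding partite_system_def
proof (intro conjI ballI allI impI assms(1-3))
  fix c :: "'v \<Rightarrow> nat"
  assume "c ` V \<subseteq> {..<k} \<and> (\<forall>x\<in>V. \<forall>y\<in>V. \<pi> x = \<pi> y \<and> \<pi> x \<notin> J \<longrightarrow> c x = c y)"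
  then show "\<exists>e\<in>E. \<exists>q. \<forall>a\<in>A. c (e a) = q" by (intro assms(4)) blast+
qed

lemma partite_systemD:
  assumes "partite_system A k g \<pi> J V E"
  shows "line_system A V E" "sparse g (\<lambda>e. e ` A) E" "\<And>e. e \<in> E \<Longrightarrow> inj_on (\<pi> \<circ> e) A"
    "\<And>c :: 'v \<Rightarrow> nat. c ` V \<subseteq> {..<k} \<Longrightarrow>
      (\<And>x y. x \<in> V \<Longrightarrow> y \<in> V \<Longrightarrow> \<pi> x = \<pi> y \<Longrightarrow> \<pi> x \<notin> J \<Longrightarrow> c x = c y) \<Longrightarrow>
      \<exists>e\<in>E. \<exists>q. \<forall>a\<in>A. c (e a) = q"
proof -
  fix c :: "'v \<Rightarrow> nat" assume "c ` V \<subseteq> {..<k}"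
    "\<And>x y. x \<in> V \<Longrightarrow> y \<in> V \<Longrightarrow> \<pi> x = \<pi> y \<Longrightarrow> \<pi> x \<notin> J \<Longrightarrow> c x = c y"
  then have "c ` V \<subseteq> {..<k} \<and> (\<forall>x\<in>V. \<forall>y\<in>V. \<pi> x = \<pi> y \<and> \<pi> x \<notin> J \<longrightarrow> c x = c y)" by blast
  with assms show "\<exists>e\<in>E. \<exists>q. \<forall>a\<in>A. c (e a) = q" unfolding partite_system_def by blast
qed (use assms in \<open>simp_all add: partite_system_def\<close>)

lemma line_systemD:
  assumes "line_system A V E"
  shows "finite V" "E \<subseteq> A \<rightarrow>\<^sub>E V" "\<And>e. e \<in> E \<Longrightarrow> inj_on e A"
    "\<And>e a. e \<in> E \<Longrightarrow> a \<in> A \<Longrightarrow> e a \<in> V"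
    "\<And>x y. x \<in> V \<Longrightarrow> y \<in> V \<Longrightarrow> x \<noteq> y \<Longrightarrow> \<exists>\<phi>. coordinate A V E \<phi> \<and> \<phi> x \<noteq> \<phi> y"
proof -
  show *: "E \<subseteq> A \<rightarrow>\<^sub>E V" using assms unfolding line_system_def by argo
  show "e a \<in> V" if "e \<in> E" "a \<in> A" for e a using * that PiE_mem by (metis subsetD)
qed (use assms in \<open>simp_all add: line_system_def\<close>)

lemma line_system_finite_edges: "line_system A V E \<Longrightarrow> finite A \<Longrightarrow> finite E"
  by (rule finite_subset[OF line_systemD(2)]) (auto intro: finite_PiE line_systemD(1))

lemma coordinateD:
  assumes "coordinate A V E \<phi>"
  shows "\<And>x. x \<in> V \<Longrightarrow> \<phi> x \<in> A"
    "\<And>e. e \<in> E \<Longrightarrow> (\<forall>a\<in>A. \<phi> (e a) = a) \<or> (\<exists>b. \<forall>a\<in>A. \<phi> (e a) = b)"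
  using assms unfolding coordinate_def by auto

section \<open>Transport of systems along injections\<close>

lemma line_system_image:
  assumes "line_system A V E" "inj_on q V"
  shows "line_system A (q ` V) ((\<lambda>e. \<lambda>a\<in>A. q (e a)) ` E)"
proof -
  note D = line_systemD[OF assms(1)]
  let ?E = "(\<lambda>e. \<lambda>a\<in>A. q (e a)) ` E"
  have "\<exists>\<phi>. coordinate A (q ` V) ?E \<phi> \<and> \<phi> (q x) \<noteq> \<phi> (q y)"
    if xy: "x \<in> V" "y \<in> V" "x \<noteq> y" for x y
  proof -
    obtain \<phi> where \<phi>: "coordinate A V E \<phi>" "\<phi> x \<noteq> \<phi> y" using D(5)[OF xy] by blast
    define \<psi> where "\<psi> = \<phi> \<circ> inv_into V q"
    have \<psi>: "\<psi> (q v) = \<phi> v" if "v \<in> V" for v using that assms(2) by (simp add: \<psi>_def)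
    have "(\<forall>a\<in>A. \<psi> ((\<lambda>a\<in>A. q (e a)) a) = a) \<or> (\<exists>b. \<forall>a\<in>A. \<psi> ((\<lambda>a\<in>A. q (e a)) a) = b)"
      if "e \<in> E" for e
      using coordinateD(2)[OF \<phi>(1) that] \<psi> D(4)[OF that] by simp
    then have "coordinate A (q ` V) ?E \<psi>"
      using coordinateD(1)[OF \<phi>(1)] \<psi> unfolding coordinate_def by auto
    then show ?thesis using \<psi> \<phi>(2) xy by metis
  qed
  moreover have "inj_on (\<lambda>a\<in>A. q (e a)) A" if "e \<in> E" for e
    using D(3,4)[OF that] assms(2) by (auto simp: inj_on_def)
  moreover have "q x \<noteq> q y \<Longrightarrow> x \<noteq> y" for x y by auto
  ultimately show ?thesis
    unfolding line_system_def using D(1,4) by auto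
qed

lemma partite_system_image:
  assumes "partite_system A k g \<pi> J V E" "inj_on q V"
  shows "partite_system A k g (\<pi> \<circ> inv_into V q) J (q ` V) ((\<lambda>e. \<lambda>a\<in>A. q (e a)) ` E)"
    (is "partite_system A k g ?\<pi> J ?V ?E")
proof -
  note P = partite_systemD[OF assms(1)]
  note D = line_systemD[OF P(1)]
  have \<pi>: "?\<pi> (q v) = \<pi> v" if "v \<in> V" for v using that assms(2) by simp
  show ?thesis
  proof (rule partite_systemI)
    show "line_system A ?V ?E" by (rule line_system_image[OF P(1) assms(2)])
    show "sparse g (\<lambda>e. e ` A) ?E"
      by (rule sparse_image[OF P(2) assms(2), where h = "\<lambda>e. \<lambda>a\<in>A. q (e a)"]) (use D(4) in auto)
    show "inj_on (?\<pi> \<circ> e) A" if "e \<in> ?E" for e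
      using that P(3) D(4) \<pi> by (auto simp: inj_on_def)
    show "\<exists>e\<in>?E. \<exists>r. \<forall>a\<in>A. c (e a) = r"
      if c: "c ` ?V \<subseteq> {..<k}"
        "\<And>x y. x \<in> ?V \<Longrightarrow> y \<in> ?V \<Longrightarrow> ?\<pi> x = ?\<pi> y \<Longrightarrow> ?\<pi> x \<notin> J \<Longrightarrow> c x = c y"
      for c :: "_ \<Rightarrow> nat"
    proof -
      have "\<exists>e\<in>E. \<exists>r. \<forall>a\<in>A. (c \<circ> q) (e a) = r"
      proof (rule P(4))
        show "(c \<circ> q) ` V \<subseteq> {..<k}" using c(1) by auto
        fix x y assume "x \<in> V" "y \<in> V" "\<pi> x = \<pi> y" "\<pi> x \<notin> J"
        then show "(c \<circ> q) x = (c \<circ> q) y"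
          using c(2)[of "q x" "q y"] \<pi> by simp
      qed
      then obtain e r where "e \<in> E" "\<forall>a\<in>A. c (q (e a)) = r" by auto
      then show ?thesis by (intro bexI[of _ "\<lambda>a\<in>A. q (e a)"] exI[of _ r]) auto
    qed
  qed
qed

text \<open>With \<open>UNIV\<close> as the set of treated parts the condition on fibres is vacuous,
  so every colouring has a monochromatic line. Vertices are natural numbers so that a part of one
  system can serve as the alphabet of another.\<close>

definition sparse_lines :: "nat set \<Rightarrow> nat \<Rightarrow> nat \<Rightarrow> bool" where
  "sparse_lines A k g \<longleftrightarrow> (\<exists>(V :: nat set) E. partite_system A k g id UNIV V E)"

text \<open>Once \<open>J\<close> contains every part, colourings are unrestricted and
  \<open>id\<close> can take the place of the projection; the finitely many vertices are then
  numbered.\<close>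

lemma sparse_linesI:
  assumes "partite_system A k g \<pi> J V E" "\<pi> ` V \<subseteq> J"
  shows "sparse_lines A k g"
proof -
  note P = partite_systemD[OF assms(1)]
  obtain q :: "_ \<Rightarrow> nat" where q: "inj_on q V"
    using finite_imp_inj_to_nat_seg[OF line_systemD(1)[OF P(1)]] by blast
  have "partite_system A k g id UNIV V E"
  proof (rule partite_systemI)
    show "\<exists>e\<in>E. \<exists>q. \<forall>a\<in>A. c (e a) = q" if "c ` V \<subseteq> {..<k}" for c :: "_ \<Rightarrow> nat"
      using that assms(2) by (intro P(4)) auto
  qed (use P line_systemD(3)[OF P(1)] in simp_all)
  from partite_system_image[OF this q]
  have "partite_system A k g id UNIV (q ` V) ((\<lambda>e. \<lambda>a\<in>A. q (e a)) ` E)"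
    using line_systemD(3)[OF line_system_image[OF P(1) q]] by (simp add: partite_system_def)
  then show ?thesis unfolding sparse_lines_def by blast
qed

lemma two_elements: "card A \<ge> 2 \<Longrightarrow> \<exists>b\<in>A. b \<noteq> a"
  by (metis One_nat_def card_le_Suc0_iff_eq card.infinite not_less_eq_eq numeral_2_eq_2 zero_le)

text \<open>The Hales-Jewett cube itself: no subfamily has fewer than 0 members, so sparseness is
  vacuous, and the coordinates are the positions of a word.\<close>

lemma sparse_lines_0:
  assumes "finite (A :: nat set)"
  shows "sparse_lines A k 0"
proof -
  obtain n where n: "HJ A k n" using Hales_Jewett[OF assms] by blast
  define E where "E = (\<lambda>w. \<lambda>a\<in>A. fill w a) ` {w. template A n w}"
  have fill_nth: "fill w a ! i = (case w ! i of None \<Rightarrow> a | Some b \<Rightarrow> b)"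
    if "template A n w" "i < n" for w a i
    using that by (simp add: fill_def template_def split: option.split)
  have "inj_on (\<lambda>a\<in>A. fill w a) A" if w: "template A n w" for w
  proof (rule inj_onI)
    fix a b assume ab: "a \<in> A" "b \<in> A" "restrict (fill w) A a = restrict (fill w) A b"
    obtain i where i: "i < n" "w ! i = None"
      using w unfolding template_def by (metis in_set_conv_nth)
    have "fill w a = fill w b" using ab by simp
    then have "fill w a ! i = fill w b ! i" by (rule arg_cong)
    then show "a = b" unfolding fill_nth[OF w i(1)] i(2) option.case .
  qed
  moreover have "\<exists>\<phi>. coordinate A (words A n) E \<phi> \<and> \<phi> u \<noteq> \<phi> v"
    if uv: "u \<in> words A n" "v \<in> words A n" "u \<noteq> v" for u v
  proof -
    obtain i where i: "i < n" "u ! i \<noteq> v ! i"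
      using uv unfolding words_def by (auto simp: list_eq_iff_nth_eq)
    have "coordinate A (words A n) E (\<lambda>u. u ! i)"
      unfolding coordinate_def
    proof (intro conjI ballI)
      show "(\<lambda>u. u ! i) ` words A n \<subseteq> A"
        using i(1) nth_mem unfolding words_def by blast
      fix e assume "e \<in> E"
      then obtain w where w: "template A n w" "e = (\<lambda>a\<in>A. fill w a)" unfolding E_def by blast
      have "e a ! i = (case w ! i of None \<Rightarrow> a | Some b \<Rightarrow> b)" if "a \<in> A" for a
        using fill_nth[OF w(1) i(1)] that w(2) by simp
      then show "(\<forall>a\<in>A. e a ! i = a) \<or> (\<exists>b. \<forall>a\<in>A. e a ! i = b)"
        by (cases "w ! i") auto
    qed
    then show ?thesis using i by blast
  qed
  ultimately have sys: "line_system A (words A n) E"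
    using finite_words[OF assms] fill_in_words unfolding line_system_def E_def by auto
  have "partite_system A k 0 id UNIV (words A n) E"
  proof (rule partite_systemI[OF sys])
    fix c :: "nat list \<Rightarrow> nat"
    assume "c ` words A n \<subseteq> {..<k}"
    then have "mono_line A n c" using n unfolding HJ_def by blast
    then obtain w q where w: "template A n w" "\<forall>a\<in>A. c (fill w a) = q"
      unfolding mono_line_def by blast
    show "\<exists>e\<in>E. \<exists>q. \<forall>a\<in>A. c (e a) = q"
      using w unfolding E_def by (intro bexI[of _ "\<lambda>a\<in>A. fill w a"]) auto
  qed (use line_systemD(3)[OF sys] in \<open>simp_all add: sparse_def\<close>)
  then show ?thesis by (rule sparse_linesI) simp
qed

text \<open>The disjoint union of the lines of a system, projected onto that system.\<close>

lemma partite_system_disjoint_lines: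
  fixes A :: "nat set"
  assumes A: "finite A" "card A \<ge> 2" and "k > 0" and "sparse_lines A k 0"
  shows "\<exists>V E (\<pi> :: (nat \<Rightarrow> nat) \<times> nat \<Rightarrow> nat). partite_system A k g \<pi> {} V E"
proof -
  obtain V0 E0 where P0: "partite_system A k 0 id UNIV (V0 :: nat set) E0"
    using assms(4) unfolding sparse_lines_def by blast
  have sys0: "line_system A V0 E0"
    and chrom: "\<And>c :: nat \<Rightarrow> nat. c ` V0 \<subseteq> {..<k} \<Longrightarrow> \<exists>e\<in>E0. \<exists>q. \<forall>a\<in>A. c (e a) = q"
    using partite_systemD[OF P0] by simp_all
  note D = line_systemD[OF sys0]
  have finE: "finite E0" using line_system_finite_edges[OF sys0 A(1)] .
  define V where "V = E0 \<times> A"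
  define E where "E = (\<lambda>e. \<lambda>a\<in>A. (e, a)) ` E0"
  define \<pi> :: "(nat \<Rightarrow> nat) \<times> nat \<Rightarrow> nat" where "\<pi> = (\<lambda>(e, a). e a)"
  have "\<exists>\<phi>. coordinate A V E \<phi> \<and> \<phi> x \<noteq> \<phi> y" if xy: "x \<in> V" "y \<in> V" "x \<noteq> y" for x y
  proof (cases "fst x = fst y")
    case True
    have "coordinate A V E snd" unfolding coordinate_def V_def E_def by auto
    then show ?thesis using True xy(3) by (metis prod_eqI)
  next
    case False
    \<comment> \<open>The lines of the union are disjoint, so a function with values in
      \<open>A\<close> that is constant on each of them is a coordinate. It will be \<open>b\<close>
      on the line of \<open>x\<close> and \<open>snd y\<close> on all others.\<close>
    obtain b where b: "b \<in> A" "b \<noteq> snd y" using two_elements[OF A(2)] by blast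
    define \<phi> where "\<phi> z = (if fst z = fst x then b else snd y)" for z :: "(nat \<Rightarrow> nat) \<times> nat"
    have "coordinate A V E \<phi>"
      using b(1) xy(2) unfolding coordinate_def V_def E_def \<phi>_def by auto
    then show ?thesis using False b(2) by (intro exI[of _ \<phi>]) (auto simp: \<phi>_def)
  qed
  then have sys: "line_system A V E"
    unfolding line_system_def using finE A(1) by (auto simp: V_def E_def inj_on_def)
  have disj: "e = e'" if "e \<in> E" "e' \<in> E" "x \<in> e ` A" "x \<in> e' ` A" for e e' x
    using that unfolding E_def by auto
  have "partite_system A k g \<pi> {} V E"
  proof (rule partite_systemI[OF sys])
    show "sparse g (\<lambda>e. e ` A) E"
      unfolding sparse_def
    proof (intro allI impI)
      fix S assume S: "S \<subseteq> E \<and> finite S \<and> S \<noteq> {} \<and> card S < g"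
      then obtain e where e: "e \<in> S" by blast
      have "(\<Union>f\<in>S - {e}. f ` A) \<inter> e ` A = {}" using disj S e by blast
      then show "\<exists>e\<in>S. leaf (\<lambda>e. e ` A) S e" using e unfolding leaf_def by blast
    qed
    show "inj_on (\<pi> \<circ> e) A" if "e \<in> E" for e
      using that D(3) unfolding E_def \<pi>_def inj_on_def by auto
    show "\<exists>e\<in>E. \<exists>q. \<forall>a\<in>A. c (e a) = q"
      if c: "c ` V \<subseteq> {..<k}"
        and fib: "\<And>x y. x \<in> V \<Longrightarrow> y \<in> V \<Longrightarrow> \<pi> x = \<pi> y \<Longrightarrow> \<pi> x \<notin> {} \<Longrightarrow> c x = c y"
      for c :: "_ \<Rightarrow> nat"
    proof -
      \<comment> \<open>Being constant on every fibre of \<open>\<pi>\<close>, \<open>c\<close>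
        descends to the vertices that lie on lines. All others get the colour 0, which is allowed
        because \<open>k > 0\<close>.\<close>
      define d where "d v = (if v \<in> \<pi> ` V then c (inv_into V \<pi> v) else 0)" for v
      have d: "d (\<pi> x) = c x" if "x \<in> V" for x
      proof -
        have im: "\<pi> x \<in> \<pi> ` V" using that by (rule imageI)
        have "c (inv_into V \<pi> (\<pi> x)) = c x"
          by (rule fib) (use that im f_inv_into_f[OF im] inv_into_into[OF im] in simp_all)
        then show ?thesis unfolding d_def using im by simp
      qed
      have "d ` V0 \<subseteq> {..<k}"
      proof (intro image_subsetI)
        fix v show "d v \<in> {..<k}"
          using c assms(3) inv_into_into[of v \<pi> V] unfolding d_def by (cases "v \<in> \<pi> ` V") auto
      qed
      from chrom[OF this] obtain e q where e: "e \<in> E0" "\<forall>a\<in>A. d (e a) = q" by blast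
      have "c (e, a) = q" if "a \<in> A" for a
        using d[of "(e, a)"] e that by (simp add: V_def \<pi>_def)
      then show ?thesis
        using e(1) unfolding E_def by (intro bexI[of _ "\<lambda>a\<in>A. (e, a)"] exI[of _ q]) auto
    qed
  qed
  then show ?thesis by blast
qed

subsection \<open>Partite amalgamation\<close>

text \<open>One copy of the system \<open>(V, E)\<close> is attached to every line of \<open>(VB, EB)\<close> by
  identifying the part \<open>U\<close> of the copy with that line.\<close>

locale amalgam =
  fixes A :: "'a set" and V :: "'v set" and E :: "('a \<Rightarrow> 'v) set"
    and U :: "'v set" and VB :: "'b set" and EB :: "('v \<Rightarrow> 'b) set"
  assumes sys: "line_system A V E" and base: "line_system U VB EB"
    and U: "U \<subseteq> V" "card U \<ge> 2"
    and finA: "finite A"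
    and meet: "\<And>f a b. f \<in> E \<Longrightarrow> a \<in> A \<Longrightarrow> b \<in> A \<Longrightarrow> f a \<in> U \<Longrightarrow> f b \<in> U \<Longrightarrow> a = b"
begin

definition embed :: "('v \<Rightarrow> 'b) \<Rightarrow> 'v \<Rightarrow> 'b + ('v \<Rightarrow> 'b) \<times> 'v" where
  "embed e v = (if v \<in> U then Inl (e v) else Inr (e, v))"

definition edge :: "('v \<Rightarrow> 'b) \<times> ('a \<Rightarrow> 'v) \<Rightarrow> 'a \<Rightarrow> 'b + ('v \<Rightarrow> 'b) \<times> 'v" where
  "edge p = (\<lambda>a\<in>A. embed (fst p) (snd p a))"

definition vertices :: "('b + ('v \<Rightarrow> 'b) \<times> 'v) set" where
  "vertices = Inl ` VB \<union> Inr ` (EB \<times> (V - U))"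

definition edges :: "('a \<Rightarrow> 'b + ('v \<Rightarrow> 'b) \<times> 'v) set" where
  "edges = edge ` (EB \<times> E)"

lemmas D = line_systemD[OF sys]
lemmas DB = line_systemD[OF base]

lemma finU: "finite U" using finite_subset[OF U(1) D(1)] .

lemma embed_in: "e \<in> EB \<Longrightarrow> v \<in> V \<Longrightarrow> embed e v \<in> vertices"
  using DB(4) by (auto simp: embed_def vertices_def)

lemma embed_inj: "e \<in> EB \<Longrightarrow> embed e u = embed e v \<Longrightarrow> u = v"
  using DB(3) by (auto simp: embed_def dest: inj_onD split: if_splits)

lemma embed_eq_imp_U: "embed e u = embed e' v \<Longrightarrow> e \<noteq> e' \<Longrightarrow> u \<in> U \<and> v \<in> U \<and> e u = e' v"
  by (auto simp: embed_def split: if_splits)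

text \<open>Combines a coordinate \<open>\<psi>\<close> of the base, with letters in
  \<open>U\<close>, and a coordinate \<open>\<phi>\<close> of \<open>V\<close>. A copy on whose line
  \<open>\<psi>\<close> is the identity is read by \<open>\<phi>\<close>; a copy on whose line
  \<open>\<psi>\<close> has a constant value \<open>b\<close> is sent to \<open>\<phi> b\<close> as
  a whole, with \<open>SOME\<close> picking a point of the line at which to read
  \<open>b\<close>.\<close>

definition lift :: "('v \<Rightarrow> 'a) \<Rightarrow> ('b \<Rightarrow> 'v) \<Rightarrow> 'b + ('v \<Rightarrow> 'b) \<times> 'v \<Rightarrow> 'a" where
  "lift \<phi> \<psi> x = (case x of Inl b \<Rightarrow> \<phi> (\<psi> b)
     | Inr (e, v) \<Rightarrow> if \<forall>u\<in>U. \<psi> (e u) = u then \<phi> v else \<phi> (\<psi> (e (SOME u. u \<in> U))))"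

lemma some_U: "(SOME u. u \<in> U) \<in> U"
  using U(2) by (intro someI_ex[of "\<lambda>u. u \<in> U"]) (metis card.empty ex_in_conv not_numeral_le_zero)

lemma lift_id: "\<forall>u\<in>U. \<psi> (e u) = u \<Longrightarrow> lift \<phi> \<psi> (embed e v) = \<phi> v"
  by (auto simp: lift_def embed_def)

lemma lift_const: "\<forall>u\<in>U. \<psi> (e u) = b \<Longrightarrow> lift \<phi> \<psi> (embed e v) = \<phi> b"
proof -
  assume b: "\<forall>u\<in>U. \<psi> (e u) = b"
  obtain u1 u2 where "u1 \<in> U" "u2 \<in> U" "u1 \<noteq> u2"
    using two_elements[OF U(2)] by blast
  then have "\<not> (\<forall>u\<in>U. \<psi> (e u) = u)" using b by metis
  then have "lift \<phi> \<psi> (embed e v) = \<phi> (\<psi> (e (if v \<in> U then v else SOME u. u \<in> U)))"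
    by (auto simp: lift_def embed_def)
  then show ?thesis using b some_U by simp
qed

lemma coordinate_lift:
  assumes \<phi>: "coordinate A V E \<phi>" and \<psi>: "coordinate U VB EB \<psi>"
  shows "coordinate A vertices edges (lift \<phi> \<psi>)"
  unfolding coordinate_def
proof (intro conjI ballI image_subsetI)
  fix x assume x: "x \<in> vertices"
  have UA: "\<phi> u \<in> A" if "u \<in> U" for u using coordinateD(1)[OF \<phi>] that U(1) by blast
  show "lift \<phi> \<psi> x \<in> A"
  proof (cases x)
    case (Inl b)
    then show ?thesis using x UA coordinateD(1)[OF \<psi>] by (auto simp: lift_def vertices_def)
  next
    case (Inr p)
    then obtain e v where ev: "x = Inr (e, v)" "e \<in> EB" "v \<in> V - U"
      using x by (auto simp: vertices_def)
    then have xe: "x = embed e v" by (simp add: embed_def)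
    from coordinateD(2)[OF \<psi> ev(2)] show ?thesis
    proof
      assume "\<forall>u\<in>U. \<psi> (e u) = u"
      then show ?thesis using lift_id xe ev(3) coordinateD(1)[OF \<phi>] by simp
    next
      assume "\<exists>b. \<forall>u\<in>U. \<psi> (e u) = b"
      then obtain b where b: "\<forall>u\<in>U. \<psi> (e u) = b" by blast
      then have "b \<in> U" using some_U DB(4)[OF ev(2) some_U] coordinateD(1)[OF \<psi>] by metis
      then show ?thesis using lift_const[of \<psi> e b \<phi> v, OF b] xe UA by simp
    qed
  qed
next
  fix h assume "h \<in> edges"
  then obtain e f where ef: "e \<in> EB" "f \<in> E" "\<And>a. a \<in> A \<Longrightarrow> h a = embed e (f a)"
    by (auto simp: edges_def edge_def)
  from coordinateD(2)[OF \<psi> ef(1)]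
  show "(\<forall>a\<in>A. lift \<phi> \<psi> (h a) = a) \<or> (\<exists>b. \<forall>a\<in>A. lift \<phi> \<psi> (h a) = b)"
  proof
    assume id: "\<forall>u\<in>U. \<psi> (e u) = u"
    have "lift \<phi> \<psi> (h a) = \<phi> (f a)" if "a \<in> A" for a
      using lift_id[of \<psi> e \<phi>, OF id] ef(3) that by simp
    then show ?thesis using coordinateD(2)[OF \<phi> ef(2)] by simp
  next
    assume "\<exists>b. \<forall>u\<in>U. \<psi> (e u) = b"
    then obtain b where b: "\<forall>u\<in>U. \<psi> (e u) = b" by blast
    then show ?thesis using lift_const[of \<psi> e b \<phi>, OF b] ef(3) by auto
  qed
qed

text \<open>A coordinate separating two points of the line \<open>e\<close> is not constant on it
  and hence is the identity there.\<close>

lemma identity_coordinate: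
  assumes "e \<in> EB"
  shows "\<exists>\<psi>. coordinate U VB EB \<psi> \<and> (\<forall>u\<in>U. \<psi> (e u) = u)"
proof -
  obtain u v where uv: "u \<in> U" "v \<in> U" "u \<noteq> v" using two_elements[OF U(2)] by blast
  then have "e u \<noteq> e v" using DB(3)[OF assms] by (auto dest: inj_onD)
  then obtain \<psi> where "coordinate U VB EB \<psi>" "\<psi> (e u) \<noteq> \<psi> (e v)"
    using DB(5) DB(4)[OF assms] uv by blast
  then show ?thesis using coordinateD(2)[OF _ assms] uv by metis
qed

text \<open>A coordinate \<open>\<psi>\<close> of the base folds the amalgam onto \<open>V\<close>,
  unfolding some copies faithfully and collapsing the others to points of \<open>U\<close>. It
  suffices that \<open>x\<close> and \<open>y\<close> are folded to different points
  \<open>p\<close> and \<open>q\<close>, which a coordinate of \<open>V\<close> then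
  separates.\<close>

lemma separated:
  assumes x: "x \<in> vertices" and y: "y \<in> vertices" and ne: "x \<noteq> y"
  shows "\<exists>\<theta>. coordinate A vertices edges \<theta> \<and> \<theta> x \<noteq> \<theta> y"
proof -
  have lifted: ?thesis
    if "coordinate U VB EB \<psi>" "p \<in> V" "q \<in> V" "p \<noteq> q"
      "\<And>\<phi>. lift \<phi> \<psi> x = \<phi> p" "\<And>\<phi>. lift \<phi> \<psi> y = \<phi> q" for \<psi> p q
    using D(5)[OF that(2-4)] coordinate_lift that by metis
  have psiU: "\<psi> b \<in> V" "\<psi> b \<in> U" if "coordinate U VB EB \<psi>" "b \<in> VB" for \<psi> b
    using coordinateD(1)[OF that] U(1) by auto
  have constU: "b \<in> U" if "coordinate U VB EB \<psi>" "e \<in> EB" "\<forall>u\<in>U. \<psi> (e u) = b" for \<psi> e b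
    using psiU(2)[OF that(1) DB(4)[OF that(2) some_U]] that(3) some_U by metis
  have Inr_embed: "Inr (e, v) = embed e v" if "v \<notin> U" for e v using that by (simp add: embed_def)
  show ?thesis
  proof (cases x; cases y)
    fix b b' assume xy: "x = Inl b" "y = Inl b'"
    have b: "b \<in> VB" "b' \<in> VB" "b \<noteq> b'" using x y ne xy by (auto simp: vertices_def)
    obtain \<psi> where \<psi>: "coordinate U VB EB \<psi>" "\<psi> b \<noteq> \<psi> b'" using DB(5)[OF b] by blast
    show ?thesis
      by (rule lifted[OF \<psi>(1) psiU(1)[OF \<psi>(1) b(1)] psiU(1)[OF \<psi>(1) b(2)] \<psi>(2)])
        (simp_all add: xy lift_def)
  next
    fix b r assume xy: "x = Inl b" "y = Inr r"
    obtain e v where r: "r = (e, v)" and ev: "e \<in> EB" "v \<in> V" "v \<notin> U" and b: "b \<in> VB"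
      using x y xy by (auto simp: vertices_def)
    obtain \<psi> where \<psi>: "coordinate U VB EB \<psi>" "\<forall>u\<in>U. \<psi> (e u) = u"
      using identity_coordinate[OF ev(1)] by blast
    have "\<psi> b \<noteq> v" using psiU(2)[OF \<psi>(1) b] ev(3) by metis
    then show ?thesis
      by (rule lifted[OF \<psi>(1) psiU(1)[OF \<psi>(1) b] ev(2)])
        (use lift_id[of \<psi> e, OF \<psi>(2)] in \<open>simp_all add: xy r Inr_embed[OF ev(3)]\<close>, simp add: lift_def)
  next
    fix b r assume xy: "x = Inr r" "y = Inl b"
    obtain e v where r: "r = (e, v)" and ev: "e \<in> EB" "v \<in> V" "v \<notin> U" and b: "b \<in> VB"
      using x y xy by (auto simp: vertices_def)
    obtain \<psi> where \<psi>: "coordinate U VB EB \<psi>" "\<forall>u\<in>U. \<psi> (e u) = u"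
      using identity_coordinate[OF ev(1)] by blast
    have "v \<noteq> \<psi> b" using psiU(2)[OF \<psi>(1) b] ev(3) by metis
    then show ?thesis
      by (rule lifted[OF \<psi>(1) ev(2) psiU(1)[OF \<psi>(1) b]])
        (use lift_id[of \<psi> e, OF \<psi>(2)] in \<open>simp_all add: xy r Inr_embed[OF ev(3)]\<close>, simp add: lift_def)
  next
    fix r r' assume xy: "x = Inr r" "y = Inr r'"
    obtain e v e' v' where r: "r = (e, v)" "r' = (e', v')"
      and e: "e \<in> EB" "v \<in> V" "v \<notin> U" and e': "e' \<in> EB" "v' \<in> V" "v' \<notin> U"
      using x y xy by (auto simp: vertices_def)
    have xe: "x = embed e v" "y = embed e' v'" using xy r Inr_embed e e' by simp_all
    show ?thesis
    proof (cases "e = e'")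
      case True
      obtain \<psi> where \<psi>: "coordinate U VB EB \<psi>" "\<forall>u\<in>U. \<psi> (e u) = u"
        using identity_coordinate[OF e(1)] by blast
      have "v \<noteq> v'" using ne xe True by metis
      then show ?thesis
        by (rule lifted[OF \<psi>(1) e(2) e'(2)])
          (use lift_id[of \<psi> e, OF \<psi>(2)] xe True in simp_all)
    next
      case False
      \<comment> \<open>Different lines of the base differ at some letter \<open>u\<close>, and a
        \<open>\<psi>\<close> separating \<open>e u\<close> from \<open>e' u\<close> is not the
        identity on both. If it is constant on exactly one, that copy collapses into
        \<open>U\<close> while \<open>v\<close> and \<open>v'\<close> lie outside; if on both, the
        constants differ.\<close>
      then obtain u where u: "u \<in> U" "e u \<noteq> e' u"
        using PiE_ext[of e U "\<lambda>_. VB" e'] DB(2) e(1) e'(1) by blast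
      obtain \<psi> where \<psi>: "coordinate U VB EB \<psi>" "\<psi> (e u) \<noteq> \<psi> (e' u)"
        using DB(5)[OF DB(4)[OF e(1) u(1)] DB(4)[OF e'(1) u(1)] u(2)] by blast
      consider "\<forall>u\<in>U. \<psi> (e u) = u" "\<forall>u\<in>U. \<psi> (e' u) = u"
        | b' where "\<forall>u\<in>U. \<psi> (e u) = u" "\<forall>u\<in>U. \<psi> (e' u) = b'"
        | b where "\<forall>u\<in>U. \<psi> (e u) = b" "\<forall>u\<in>U. \<psi> (e' u) = u"
        | b b' where "\<forall>u\<in>U. \<psi> (e u) = b" "\<forall>u\<in>U. \<psi> (e' u) = b'"
        using coordinateD(2)[OF \<psi>(1) e(1)] coordinateD(2)[OF \<psi>(1) e'(1)] by blast
      then show ?thesis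
      proof cases
        case 1
        then show ?thesis using \<psi>(2) u(1) by metis
      next
        case (2 b')
        have b': "b' \<in> U" using constU[OF \<psi>(1) e'(1) 2(2)] .
        then have "b' \<in> V" "v \<noteq> b'" using U(1) e(3) by auto
        then show ?thesis
          by (intro lifted[OF \<psi>(1) e(2)])
            (use lift_id[of \<psi> e, OF 2(1)] lift_const[of \<psi> e', OF 2(2)] xe in simp_all)
      next
        case (3 b)
        have b: "b \<in> U" using constU[OF \<psi>(1) e(1) 3(1)] .
        then have "b \<in> V" "b \<noteq> v'" using U(1) e'(3) by auto
        then show ?thesis
          by (intro lifted[OF \<psi>(1) _ e'(2)])
            (use lift_id[of \<psi> e', OF 3(2)] lift_const[of \<psi> e, OF 3(1)] xe in simp_all)
      next
        case (4 b b')
        have "b \<in> U" "b' \<in> U" using constU[OF \<psi>(1) e(1) 4(1)] constU[OF \<psi>(1) e'(1) 4(2)] .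
        then have "b \<in> V" "b' \<in> V" "b \<noteq> b'" using U(1) \<psi>(2) u(1) 4 by auto
        then show ?thesis
          by (intro lifted[OF \<psi>(1)])
            (use lift_const[of \<psi> e', OF 4(2)] lift_const[of \<psi> e, OF 4(1)] xe in simp_all)
      qed
    qed
  qed
qed

lemma line_system: "line_system A vertices edges"
  unfolding line_system_def
proof (intro conjI ballI impI separated)
  have "finite EB" using line_system_finite_edges[OF base finU] .
  then show "finite vertices" using D(1) DB(1) by (simp add: vertices_def)
  show "edges \<subseteq> A \<rightarrow>\<^sub>E vertices" using D(4) embed_in by (auto simp: edges_def edge_def)
  show "inj_on h A" if "h \<in> edges" for h
    using that D(3) embed_inj by (auto simp: edges_def edge_def inj_on_def)
qed

text \<open>A copy contributing a single line \<open>f\<close> meets the other copies only in the at most one point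
  of \<open>f\<close> in \<open>U\<close>. If every copy contributes at least two lines, then fewer than \<open>g - 1\<close> copies
  are involved, and a leaf among these copies contains a leaf.\<close>

lemma sparse_amalgam:
  assumes sp: "sparse g (\<lambda>f. f ` A) E" and spB: "sparse (g - 1) (\<lambda>e. e ` U) EB"
  shows "sparse g (\<lambda>h. h ` A) edges"
proof -
  define N where "N p = edge p ` A" for p
  have Nmem: "\<exists>v\<in>snd p ` A. v \<in> V \<and> u = embed (fst p) v" if "u \<in> N p" "p \<in> EB \<times> E" for u p
    using that D(4) unfolding N_def edge_def by auto
  have "sparse g N (EB \<times> E)"
    unfolding sparse_def
  proof (intro allI impI)
    fix S assume S: "S \<subseteq> EB \<times> E \<and> finite S \<and> S \<noteq> {} \<and> card S < g"
    define R where "R e = {f. (e, f) \<in> S}" for e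
    define C where "C = fst ` S"
    have finR: "finite (R e)" for e
      unfolding R_def using S finite_subset[of "R e" "snd ` S"] by (force simp: R_def)
    have SE: "S \<subseteq> EB \<times> E" using S by blast
    have SR: "S = Sigma C R" by (force simp: C_def R_def)
    have RE: "R e \<subseteq> E" for e using S by (auto simp: R_def)
    have CEB: "C \<subseteq> EB" and C: "finite C" "C \<noteq> {}" using S by (auto simp: C_def)
    have cardS: "card S = (\<Sum>e\<in>C. card (R e))"
      unfolding SR using C finR by (simp add: card_SigmaI)
    show "\<exists>p\<in>S. leaf N S p"
    proof (cases "\<exists>e f. R e = {f}")
      case True
      then obtain e f where Re: "R e = {f}" by blast
      then have ef: "(e, f) \<in> S" and eB: "e \<in> EB" "f \<in> E" using S by (auto simp: R_def)
      have key: "\<exists>a\<in>A. f a \<in> U \<and> u = embed e (f a)"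
        if u: "u \<in> N (e, f)" "u \<in> (\<Union>p\<in>S - {(e, f)}. N p)" for u
      proof -
        obtain e' f' where p: "(e', f') \<in> S" "(e', f') \<noteq> (e, f)" "u \<in> N (e', f')"
          using u(2) by auto
        have "e' \<noteq> e" using p Re by (auto simp: R_def)
        moreover obtain v where "v \<in> f ` A" "u = embed e v"
          using Nmem[OF u(1)] eB by auto
        moreover obtain v' where "u = embed e' v'"
          using Nmem[OF p(3) subsetD[OF SE p(1)]] by auto
        ultimately show ?thesis using embed_eq_imp_U[of e v e' v'] by auto
      qed
      have "leaf N S (e, f)"
        unfolding leaf_def using key meet[OF eB(2)] by metis
      then show ?thesis using ef by blast
    next
      case False
      have "card (R e) \<ge> 2" if "e \<in> C" for e
      proof -
        have "R e \<noteq> {}" using that by (auto simp: C_def R_def)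
        then have "card (R e) \<noteq> 0" using finR by simp
        moreover have "card (R e) \<noteq> 1" using False by (auto simp: card_1_singleton_iff)
        ultimately show ?thesis by linarith
      qed
      \<comment> \<open>From 2 |C| \<le> |S| < g and |C| > 0 follows |C| < g - 1, the range in which
        the base has leaves.\<close>
      then have "(\<Sum>e\<in>C. 2) \<le> card S" unfolding cardS by (intro sum_mono)
      moreover have "card C > 0" using C by (simp add: card_gt_0_iff)
      moreover have "card S < g" using S by blast
      ultimately have "card C < g - 1" by simp
      then obtain e where e: "e \<in> C" "leaf (\<lambda>e. e ` U) C e"
        using spB C CEB unfolding sparse_def by blast
      have eB: "e \<in> EB" using e CEB by blast
      have Re: "R e \<noteq> {}" using e(1) by (auto simp: C_def R_def)
      \<comment> \<open>At most one \<open>w\<close> in \<open>U\<close> marks a point where the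
        copy \<open>e\<close> can touch the other copies in \<open>C\<close>; if there is none,
        \<open>w\<close> is arbitrary. It becomes the extra point of
        \<open>sparse_pointed_leaf\<close>.\<close>
      have "\<exists>w. \<forall>u\<in>U. e u \<in> (\<Union>e'\<in>C - {e}. e' ` U) \<longrightarrow> u = w"
      proof (cases "\<exists>w\<in>U. e w \<in> (\<Union>e'\<in>C - {e}. e' ` U)")
        case True
        then obtain w where w: "w \<in> U" "e w \<in> (\<Union>e'\<in>C - {e}. e' ` U)" by blast
        have "u = w" if u: "u \<in> U" "e u \<in> (\<Union>e'\<in>C - {e}. e' ` U)" for u
        proof -
          have "e u = e w" using e(2) w u unfolding leaf_def by blast
          then show ?thesis using DB(3)[OF eB] u(1) w(1) by (auto dest: inj_onD)
        qed
        then show ?thesis by blast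
      qed blast
      then obtain w where w: "\<And>u. u \<in> U \<Longrightarrow> e u \<in> (\<Union>e'\<in>C - {e}. e' ` U) \<Longrightarrow> u = w" by blast
      have "card (R e) \<le> card S"
        unfolding cardS using e(1) C(1) by (intro member_le_sum) auto
      then have "card (R e) < g" using S by simp
      from sparse_pointed_leaf[OF sp RE finR Re this, of w]
      obtain f where f: "f \<in> R e" and fleaf: "\<And>u v. u \<in> f ` A \<and> v \<in> f ` A \<and>
        (u = w \<or> u \<in> (\<Union>f'\<in>R e - {f}. f' ` A)) \<and> (v = w \<or> v \<in> (\<Union>f'\<in>R e - {f}. f' ` A)) \<Longrightarrow> u = v"
        by blast
      have ef: "(e, f) \<in> S" using f by (simp add: R_def)
      have key: "\<exists>v\<in>f ` A. u = embed e v \<and> (v = w \<or> v \<in> (\<Union>f'\<in>R e - {f}. f' ` A))"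
        if u: "u \<in> N (e, f)" "u \<in> (\<Union>p\<in>S - {(e, f)}. N p)" for u
      proof -
        obtain e' f' where p: "(e', f') \<in> S" "(e', f') \<noteq> (e, f)" "u \<in> N (e', f')"
          using u(2) by auto
        obtain v where v: "v \<in> f ` A" "u = embed e v"
          using Nmem[OF u(1) subsetD[OF SE ef]] by auto
        obtain v' where v': "v' \<in> f' ` A" "u = embed e' v'"
          using Nmem[OF p(3) subsetD[OF SE p(1)]] by auto
        show ?thesis
        proof (cases "e' = e")
          case True
          then have "v' = v" "f' \<in> R e - {f}"
            using embed_inj[OF eB, of v' v] v v' p by (auto simp: R_def)
          then show ?thesis using v v' by blast
        next
          case False
          then have vU: "v \<in> U" "v' \<in> U" "e v = e' v'"
            using embed_eq_imp_U[of e v e' v'] v v' by auto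
          moreover have "e' \<in> C - {e}" using False p(1) by (force simp: C_def)
          ultimately have "v = w" by (intro w) auto
          then show ?thesis using v by blast
        qed
      qed
      have "leaf N S (e, f)"
        unfolding leaf_def using key fleaf by metis
      then show ?thesis using ef by blast
    qed
  qed
  then show ?thesis
    by (rule sparse_image[where q = id and V = UNIV and h = edge]) (auto simp: edges_def N_def)
qed

end

section \<open>Iterated amalgamation and induction on the girth\<close>

lemma partite_system_to_nat:
  assumes "partite_system A k g \<pi> J V E"
  shows "\<exists>(V' :: nat set) E' \<pi>'. partite_system A k g \<pi>' J V' E' \<and> \<pi>' ` V' = \<pi> ` V"
proof -
  obtain q :: "_ \<Rightarrow> nat" where q: "inj_on q V"
    using finite_imp_inj_to_nat_seg[OF line_systemD(1)[OF partite_systemD(1)[OF assms]]] by blast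
  have "(\<pi> \<circ> inv_into V q) ` q ` V = \<pi> ` V"
    using q by (simp add: image_comp)
  then show ?thesis using partite_system_image[OF assms q] by blast
qed

text \<open>A colouring of the amalgam is constant on some line of the base, whose letters are the
  vertices over \<open>x\<close>. On the copy attached there the part over \<open>x\<close> thus has
  one colour, so the given system supplies a monochromatic line without any assumption on
  \<open>x\<close>.\<close>

lemma partite_amalgamation:
  fixes V :: "nat set" and A :: "nat set"
  assumes A: "finite A" "card A \<ge> 2" and P: "partite_system A k g \<pi> J V E"
    and IH: "\<And>U. finite U \<Longrightarrow> card U \<ge> 2 \<Longrightarrow> sparse_lines U k (g - 1)"
  shows "\<exists>(V' :: nat set) E' \<pi>'. partite_system A k g \<pi>' (insert x J) V' E' \<and>
    \<pi>' ` V' \<subseteq> insert x (\<pi> ` V)"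
proof -
  note P' = partite_systemD[OF P]
  note D = line_systemD[OF P'(1)]
  define U where "U = {v \<in> V. \<pi> v = x}"
  have finU: "finite U" using D(1) by (simp add: U_def)
  show ?thesis
  proof (cases "card U \<ge> 2")
    case False
    then have "\<forall>u\<in>U. \<forall>v\<in>U. u = v"
      using card_le_Suc0_iff_eq[OF finU] by (metis One_nat_def Suc_1 not_less_eq_eq)
    then have single: "u = v" if "u \<in> V" "v \<in> V" "\<pi> u = x" "\<pi> v = x" for u v
      using that by (simp add: U_def)
    have "partite_system A k g \<pi> (insert x J) V E"
    proof (rule partite_systemI[OF P'(1-3)])
      fix c :: "nat \<Rightarrow> nat"
      assume c: "c ` V \<subseteq> {..<k}" and fib: "\<And>u v. u \<in> V \<Longrightarrow> v \<in> V \<Longrightarrow> \<pi> u = \<pi> v \<Longrightarrow> \<pi> u \<notin> insert x J \<Longrightarrow> c u = c v"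
      show "\<exists>e\<in>E. \<exists>q. \<forall>a\<in>A. c (e a) = q"
      proof (rule P'(4)[OF c])
        fix u v assume uv: "u \<in> V" "v \<in> V" "\<pi> u = \<pi> v" "\<pi> u \<notin> J"
        show "c u = c v"
        proof (cases "\<pi> u = x")
          case True
          then have "u = v" using single uv by metis
          then show ?thesis by simp
        next
          case False
          then show ?thesis using fib[OF uv(1-3)] uv(4) by blast
        qed
      qed
    qed
    then show ?thesis by blast
  next
    case True
    obtain VB :: "nat set" and EB where B: "partite_system U k (g - 1) id UNIV VB EB"
      using IH[OF finU True] unfolding sparse_lines_def by blast
    note B' = partite_systemD[OF B]
    interpret amalgam A V E U VB EB
    proof
      show "a = b" if "f \<in> E" "a \<in> A" "b \<in> A" "f a \<in> U" "f b \<in> U" for f a b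
        using inj_onD[OF P'(3)[OF that(1)], of a b] that(2-5) by (simp add: U_def)
    qed (use P'(1) B'(1) True A(1) in \<open>auto simp: U_def\<close>)
    \<comment> \<open>All base vertices lie over \<open>x\<close>, and every other vertex keeps the
      part it has in its copy, so \<open>\<rho>\<close> restricts to \<open>\<pi>\<close> on each
      copy.\<close>
    define \<rho> :: "nat + (nat \<Rightarrow> nat) \<times> nat \<Rightarrow> _" where "\<rho> = case_sum (\<lambda>_. x) (\<lambda>(e, v). \<pi> v)"
    have \<rho>: "\<rho> (embed e v) = \<pi> v" if "v \<in> V" for e v
    proof (cases "v \<in> U")
      case True
      then have "\<pi> v = x" by (simp add: U_def)
      then show ?thesis using True by (simp add: \<rho>_def embed_def)
    qed (simp add: \<rho>_def embed_def)
    have Q: "partite_system A k g \<rho> (insert x J) vertices edges"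
    proof (rule partite_systemI[OF line_system sparse_amalgam[OF P'(2) B'(2)]])
      fix h assume "h \<in> edges"
      then obtain e f where ef: "f \<in> E" "\<And>a. a \<in> A \<Longrightarrow> h a = embed e (f a)"
        by (auto simp: edges_def edge_def)
      have "(\<rho> \<circ> h) a = (\<pi> \<circ> f) a" if "a \<in> A" for a
        using ef(2)[OF that] \<rho> D(4)[OF ef(1) that] by simp
      then show "inj_on (\<rho> \<circ> h) A" using P'(3)[OF ef(1)] inj_on_cong by metis
    next
      fix c :: "_ \<Rightarrow> nat"
      assume c: "c ` vertices \<subseteq> {..<k}" and fib: "\<And>u v. u \<in> vertices \<Longrightarrow> v \<in> vertices \<Longrightarrow>
        \<rho> u = \<rho> v \<Longrightarrow> \<rho> u \<notin> insert x J \<Longrightarrow> c u = c v"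
      have "(c \<circ> Inl) ` VB \<subseteq> {..<k}" using c by (auto simp: vertices_def)
      then have "\<exists>e\<in>EB. \<exists>r. \<forall>u\<in>U. (c \<circ> Inl) (e u) = r" by (rule B'(4)) simp
      then obtain e r where e: "e \<in> EB" "\<And>u. u \<in> U \<Longrightarrow> c (Inl (e u)) = r" by auto
      have "\<exists>f\<in>E. \<exists>q. \<forall>a\<in>A. (c \<circ> embed e) (f a) = q"
      proof (rule P'(4))
        show "(c \<circ> embed e) ` V \<subseteq> {..<k}" using c embed_in[OF e(1)] by auto
        fix u v assume uv: "u \<in> V" "v \<in> V" "\<pi> u = \<pi> v" "\<pi> u \<notin> J"
        show "(c \<circ> embed e) u = (c \<circ> embed e) v"
        proof (cases "\<pi> u = x")
          case True
          then have "u \<in> U" "v \<in> U" using uv by (auto simp: U_def)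
          then show ?thesis using e(2) by (simp add: embed_def)
        next
          case False
          then show ?thesis
            using fib[OF embed_in[OF e(1) uv(1)] embed_in[OF e(1) uv(2)]] \<rho> uv by simp
        qed
      qed
      then obtain f q where f: "f \<in> E" "\<forall>a\<in>A. c (embed e (f a)) = q" by auto
      have "edge (e, f) \<in> edges" using e(1) f(1) by (auto simp: edges_def)
      moreover have "\<forall>a\<in>A. c (edge (e, f) a) = q" using f(2) by (simp add: edge_def)
      ultimately show "\<exists>h\<in>edges. \<exists>q. \<forall>a\<in>A. c (h a) = q" by blast
    qed
    have "\<rho> ` vertices \<subseteq> insert x (\<pi> ` V)" by (auto simp: \<rho>_def vertices_def)
    then show ?thesis using partite_system_to_nat[OF Q] by metis
  qed
qed

text \<open>The outer induction on \<open>g\<close> covers all alphabets at once, because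
  amalgamation calls it with a part as the alphabet. The inner induction treats the parts one by
  one, starting from disjoint lines; the finite set \<open>X\<close> of parts stays fixed because
  amalgamation over a point of \<open>X\<close> creates no part outside \<open>X\<close>.\<close>

theorem sparse_Hales_Jewett:
  assumes "finite (A :: nat set)" "card A \<ge> 2" "k > 0"
  shows "sparse_lines A k g"
  using assms(1,2)
proof (induction g arbitrary: A)
  case 0
  show ?case using sparse_lines_0[OF 0(1)] .
next
  case (Suc g)
  obtain V0 :: "nat set" and E0 and \<pi>0 :: "nat \<Rightarrow> nat" where
    P0: "partite_system A k (Suc g) \<pi>0 {} V0 E0"
    using partite_system_disjoint_lines[OF Suc.prems assms(3) sparse_lines_0[OF Suc.prems(1)]]
      partite_system_to_nat by blast
  define X where "X = \<pi>0 ` V0"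
  have finX: "finite X"
    unfolding X_def using line_systemD(1)[OF partite_systemD(1)[OF P0]] by simp
  have "\<exists>(V :: nat set) E \<pi>. partite_system A k (Suc g) \<pi> J V E \<and> \<pi> ` V \<subseteq> X" if "J \<subseteq> X" for J
    using finite_subset[OF that finX] that
  proof (induction J rule: finite_induct)
    case empty
    then show ?case using P0 unfolding X_def by blast
  next
    case (insert x J)
    then obtain V :: "nat set" and E \<pi> where V: "partite_system A k (Suc g) \<pi> J V E" "\<pi> ` V \<subseteq> X"
      by blast
    obtain V' :: "nat set" and E' \<pi>' where V': "partite_system A k (Suc g) \<pi>' (insert x J) V' E'"
      "\<pi>' ` V' \<subseteq> insert x (\<pi> ` V)"
      using partite_amalgamation[OF Suc.prems V(1), of x] Suc.IH by auto
    then show ?case using V(2) insert.prems by blast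
  qed
  then obtain V :: "nat set" and E \<pi> where "partite_system A k (Suc g) \<pi> X V E" "\<pi> ` V \<subseteq> X" by blast
  then show ?case by (rule sparse_linesI)
qed

text \<open>Each member of a cycle contains two different connecting points, one shared with its
  predecessor and one with its successor, so the members form a subfamily without a leaf.\<close>

lemma sparse_imp_not_cycle:
  assumes sp: "sparse g (\<lambda>S. S) \<T>" and "set Ts \<subseteq> \<T>" "length Ts < g"
  shows "\<not> cycle_on X Ts"
proof
  assume cyc: "cycle_on X Ts"
  define n where "n = length Ts"
  have n: "n \<ge> 2" and dist: "distinct Ts" using cyc by (auto simp: cycle_on_def n_def)
  obtain xs where xs: "length xs = n" "distinct xs"
    "\<And>i. Suc i < n \<Longrightarrow> xs ! i \<in> Ts ! i \<inter> Ts ! Suc i" "last xs \<in> last Ts \<inter> hd Ts"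
    using cyc unfolding cycle_on_def n_def by blast
  have closing: "xs ! (n - 1) \<in> Ts ! (n - 1) \<inter> Ts ! 0"
  proof -
    have "xs \<noteq> []" "Ts \<noteq> []" using xs(1) n by (auto simp: n_def)
    then show ?thesis using xs(1,4) by (simp add: last_conv_nth hd_conv_nth n_def)
  qed
  have "card (set Ts) < g" using card_length[of Ts] assms(3) by linarith
  moreover have "set Ts \<noteq> {}" using n by (auto simp: n_def)
  ultimately obtain T where T: "T \<in> set Ts" "leaf (\<lambda>S. S) (set Ts) T"
    using sp assms(2) unfolding sparse_def by blast
  then obtain i where i: "i < n" "T = Ts ! i" by (metis in_set_conv_nth n_def)
  \<comment> \<open>\<open>j\<close> and \<open>l\<close> are the cyclic predecessor and successor
    of position \<open>i\<close>. For \<open>n = 2\<close> they coincide, but \<open>xs ! i\<close>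
    and \<open>xs ! j\<close> are still different points.\<close>
  define j where "j = (if i = 0 then n - 1 else i - 1)"
  define l where "l = (if i = n - 1 then 0 else Suc i)"
  have jl: "j < n" "l < n" "j \<noteq> i" "l \<noteq> i" using i n by (auto simp: j_def l_def)
  have "xs ! i \<in> Ts ! i \<inter> Ts ! l" using xs(3)[of i] closing i n by (auto simp: l_def)
  moreover have "xs ! j \<in> Ts ! i \<inter> Ts ! j"
    using xs(3)[of "i - 1"] closing i n by (cases "i = 0") (auto simp: j_def)
  moreover have "Ts ! m \<in> set Ts - {T}" if "m < n" "m \<noteq> i" for m
    using that dist i by (simp add: n_def nth_eq_iff_index_eq)
  ultimately have "xs ! i = xs ! j"
    using T(2) i(2) jl unfolding leaf_def by blast
  then show False using xs(1,2) i(1) jl by (simp add: nth_eq_iff_index_eq)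
qed

subsection \<open>Generic realisation\<close>

definition polynomial_fun :: "(real \<Rightarrow> real) \<Rightarrow> bool" where
  "polynomial_fun h \<longleftrightarrow> (\<exists>q. \<forall>s. h s = poly q s)"

lemma polynomial_fun_const: "polynomial_fun (\<lambda>_. c)"
  unfolding polynomial_fun_def by (rule exI[of _ "[:c:]"]) simp

lemma polynomial_fun_id: "polynomial_fun (\<lambda>s. s)"
  unfolding polynomial_fun_def by (rule exI[of _ "[:0, 1:]"]) simp

lemma polynomial_fun_add:
  "polynomial_fun f \<Longrightarrow> polynomial_fun h \<Longrightarrow> polynomial_fun (\<lambda>s. f s + h s)"
  unfolding polynomial_fun_def by (metis poly_add)

lemma polynomial_fun_diff:
  "polynomial_fun f \<Longrightarrow> polynomial_fun h \<Longrightarrow> polynomial_fun (\<lambda>s. f s - h s)"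
  unfolding polynomial_fun_def by (metis poly_diff)

lemma polynomial_fun_mult:
  "polynomial_fun f \<Longrightarrow> polynomial_fun h \<Longrightarrow> polynomial_fun (\<lambda>s. f s * h s)"
  unfolding polynomial_fun_def by (metis poly_mult)

lemma polynomial_fun_power: "polynomial_fun f \<Longrightarrow> polynomial_fun (\<lambda>s. f s ^ n)"
  unfolding polynomial_fun_def by (metis poly_power)

lemma polynomial_fun_sum:
  "(\<And>i. i \<in> I \<Longrightarrow> polynomial_fun (f i)) \<Longrightarrow> polynomial_fun (\<lambda>s. \<Sum>i\<in>I. f i s)"
  by (induction I rule: infinite_finite_induct)
    (simp_all add: polynomial_fun_const polynomial_fun_add)

lemma polynomial_fun_prod:
  "(\<And>i. i \<in> I \<Longrightarrow> polynomial_fun (f i)) \<Longrightarrow> polynomial_fun (\<lambda>s. \<Prod>i\<in>I. f i s)"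
  by (induction I rule: infinite_finite_induct)
    (simp_all add: polynomial_fun_const polynomial_fun_mult)

lemma finite_zeros_polynomial_fun:
  assumes "polynomial_fun h" "h t \<noteq> 0"
  shows "finite {s. h s = 0}"
proof -
  obtain q where q: "h s = poly q s" for s using assms(1) unfolding polynomial_fun_def by blast
  then have "q \<noteq> 0" using assms(2) by auto
  then show ?thesis using poly_roots_finite[of q] q by simp
qed

text \<open>The coordinates are chosen one at a time: a function that is nonzero at some \<open>m\<close> has
  only finitely many zeros on the line through \<open>m\<close> in a coordinate direction.\<close>

lemma generic_positive_point:
  fixes G :: "(('i \<Rightarrow> real) \<Rightarrow> real) set"
  assumes "finite I" "countable G"
    and poly: "\<And>h l i. h \<in> G \<Longrightarrow> polynomial_fun (\<lambda>s. h (l(i := s)))"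
    and nonzero: "\<And>h. h \<in> G \<Longrightarrow> \<exists>m. h m \<noteq> 0"
  shows "\<exists>l. (\<forall>i\<in>I. l i > 0) \<and> (\<forall>h\<in>G. \<exists>m. (\<forall>i\<in>I. m i = l i) \<and> h m \<noteq> 0)"
  using assms(1)
proof (induction I rule: finite_induct)
  case empty
  then show ?case using nonzero by blast
next
  case (insert i I)
  then obtain l where l: "\<forall>i\<in>I. l i > 0" "\<forall>h\<in>G. \<exists>m. (\<forall>i\<in>I. m i = l i) \<and> h m \<noteq> 0" by blast
  then obtain m where m: "\<And>h. h \<in> G \<Longrightarrow> (\<forall>i\<in>I. m h i = l i) \<and> h (m h) \<noteq> 0" by metis
  define Z where "Z = (\<Union>h\<in>G. {s. h ((m h)(i := s)) = 0})"
  have "finite {s. h ((m h)(i := s)) = 0}" if "h \<in> G" for h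
    by (rule finite_zeros_polynomial_fun[OF poly[OF that], where t = "m h i"]) (simp add: m that)
  then have "countable Z"
    unfolding Z_def using assms(2) by (intro countable_UN) (auto intro: countable_finite)
  then have "uncountable ({0<..<1::real} - Z)"
    by (intro uncountable_minus_countable) (simp add: uncountable_open_interval)
  then have "{0<..<1::real} - Z \<noteq> {}" by (metis countable_empty)
  then obtain s where "s \<in> {0<..<1} - Z" by blast
  then have s: "0 < s" "s \<notin> Z" by auto
  show ?case
  proof (rule exI[of _ "l(i := s)"], intro conjI ballI)
    show "(l(i := s)) j > 0" if "j \<in> insert i I" for j using that s l by auto
    fix h assume h: "h \<in> G"
    have "h ((m h)(i := s)) \<noteq> 0" using s(2) h by (auto simp: Z_def)
    moreover have "\<forall>j\<in>insert i I. ((m h)(i := s)) j = (l(i := s)) j"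
      using m[OF h] by auto
    ultimately show "\<exists>m. (\<forall>j\<in>insert i I. m j = (l(i := s)) j) \<and> h m \<noteq> 0" by blast
  qed
qed

section \<open>Placement of a line system in space\<close>

lemma polynomial_fun_eval_pair:
  assumes "\<And>j. polynomial_fun (\<lambda>s. p s $ j)" "\<And>j. polynomial_fun (\<lambda>s. q s $ j)"
  shows "polynomial_fun (\<lambda>s. eval_pair f (p s) (q s))"
proof -
  have "polynomial_fun (\<lambda>s. case_sum (($) (p s)) (($) (q s)) v)" for v
    using assms by (cases v) simp_all
  then show ?thesis
    unfolding eval_pair_def eval_mpoly_def
    by (intro polynomial_fun_sum polynomial_fun_mult polynomial_fun_const polynomial_fun_prod
        polynomial_fun_power)
qed

lemma line_system_realisation:
  fixes T :: "(real ^ 'd::finite) set" and F :: "('d + 'd) real_mpoly set"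
  assumes sys: "line_system A V E" and A: "finite A" "card A \<ge> 2" and \<tau>: "bij_betw \<tau> A T"
    and F: "countable F" "respects_set F T"
  shows "\<exists>p. inj_on p V \<and> respects_set F (p ` V) \<and> (\<forall>e\<in>E. homothetic_copy T (p ` e ` A))"
proof -
  note D = line_systemD[OF sys]
  define I where "I = {(x, y). x \<in> V \<and> y \<in> V \<and> x \<noteq> y}"
  have finI: "finite I"
    by (rule finite_subset[of _ "V \<times> V"]) (auto simp: I_def D(1))
  have "\<exists>\<phi>. coordinate A V E \<phi> \<and> \<phi> (fst i) \<noteq> \<phi> (snd i)" if "i \<in> I" for i
    using that D(5) by (auto simp: I_def)
  then obtain \<phi> where \<phi>: "\<And>i. i \<in> I \<Longrightarrow> coordinate A V E (\<phi> i) \<and> \<phi> i (fst i) \<noteq> \<phi> i (snd i)"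
    by metis
  \<comment> \<open>One weight \<open>l i\<close> for each ordered pair \<open>i\<close> of distinct
    vertices, attached to a coordinate \<open>\<phi> i\<close> that separates the pair.\<close>
  define p where "p l v = (\<Sum>i\<in>I. l i *\<^sub>R \<tau> (\<phi> i v))" for l v
  have \<phi>A: "\<phi> i v \<in> A" if "i \<in> I" "v \<in> V" for i v 
    using coordinateD(1)[OF conjunct1[OF \<phi>[OF that(1)]] that(2)] .
  have \<tau>T: "\<tau> a \<in> T" if "a \<in> A" for a using \<tau> that by (auto simp: bij_betw_def)
  have \<tau>\<phi>: "\<tau> (\<phi> i x) \<noteq> \<tau> (\<phi> i y)" "\<tau> (\<phi> i x) \<in> T" "\<tau> (\<phi> i y) \<in> T"
    if "(x, y) = i" "i \<in> I" for x y i
  proof -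
    have "x \<in> V" "y \<in> V" using that by (auto simp: I_def)
    then have "\<phi> i x \<in> A" "\<phi> i y \<in> A" "\<phi> i x \<noteq> \<phi> i y" using \<phi>A \<phi>[OF that(2)] that by auto
    then show "\<tau> (\<phi> i x) \<noteq> \<tau> (\<phi> i y)" "\<tau> (\<phi> i x) \<in> T" "\<tau> (\<phi> i y) \<in> T"
      using \<tau> \<tau>T by (auto simp: bij_betw_def dest: inj_onD)
  qed
  have poly_p: "polynomial_fun (\<lambda>s. p (l(i := s)) v $ j)" for l i v j
  proof -
    have "polynomial_fun (\<lambda>s. (l(i := s)) k)" for k
      by (cases "k = i") (simp_all add: polynomial_fun_const polynomial_fun_id)
    then show ?thesis
      unfolding p_def sum_component vector_scaleR_component real_scaleR_def
      by (intro polynomial_fun_sum polynomial_fun_mult polynomial_fun_const)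
  qed
  \<comment> \<open>The unit weight at \<open>i\<close> recovers
    \<open>\<tau> \<circ> \<phi> i\<close>, which sends the pair \<open>i\<close> to distinct points
    of \<open>T\<close>. There the functions of \<open>G\<close> belonging to \<open>i\<close> will
    be seen to be nonzero.\<close>
  have p_unit: "p (\<lambda>k. if k = i then 1 else 0) v = \<tau> (\<phi> i v)" if "i \<in> I" for i v
  proof -
    have "p (\<lambda>k. if k = i then 1 else 0) v = (\<Sum>k\<in>I. if k = i then \<tau> (\<phi> i v) else 0)"
      unfolding p_def by (intro sum.cong) auto
    then show ?thesis using finI that by simp
  qed
  have p_cong: "p m v = p l v" if "\<forall>i\<in>I. m i = l i" for m l v
    unfolding p_def using that by (intro sum.cong) auto
  \<comment> \<open>\<open>respects_set\<close> constrains only distinct points, so injectivity of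
    \<open>p l\<close> is requested separately, through squared distances that must not
    vanish.\<close>
  define G where "G = (\<lambda>(f, i) l. eval_pair f (p l (fst i)) (p l (snd i))) ` (F \<times> I) \<union>
    (\<lambda>i l. \<Sum>j\<in>UNIV. (p l (fst i) $ j - p l (snd i) $ j) ^ 2) ` I"
  have "\<exists>l. (\<forall>i\<in>I. l i > 0) \<and> (\<forall>h\<in>G. \<exists>m. (\<forall>i\<in>I. m i = l i) \<and> h m \<noteq> 0)"
  proof (rule generic_positive_point[OF finI])
    show "countable G"
      unfolding G_def using F(1) finI by (intro countable_Un countable_image countable_SIGMA) (auto intro: countable_finite)
    show "polynomial_fun (\<lambda>s. h (l(i := s)))" if "h \<in> G" for h l i
      using that unfolding G_def
      by (auto intro!: polynomial_fun_eval_pair polynomial_fun_sum polynomial_fun_power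
          polynomial_fun_diff poly_p)
    fix h assume "h \<in> G"
    then consider f x y where "f \<in> F" "(x, y) \<in> I" "h = (\<lambda>l. eval_pair f (p l x) (p l y))"
      | x y where "(x, y) \<in> I" "h = (\<lambda>l. \<Sum>j\<in>UNIV. (p l x $ j - p l y $ j) ^ 2)"
      unfolding G_def by fastforce
    then show "\<exists>m. h m \<noteq> 0"
    proof cases
      case (1 f x y)
      have "h (\<lambda>k. if k = (x, y) then 1 else 0) \<noteq> 0"
        unfolding 1(3) p_unit[OF 1(2)]
        using F(2) 1(1) \<tau>\<phi>[OF refl 1(2)] unfolding respects_set_def by blast
      then show ?thesis by blast
    next
      case (2 x y)
      obtain j where "\<tau> (\<phi> (x, y) x) $ j \<noteq> \<tau> (\<phi> (x, y) y) $ j"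
        using \<tau>\<phi>(1)[OF refl 2(1)] by (auto simp: vec_eq_iff)
      then have "h (\<lambda>k. if k = (x, y) then 1 else 0) \<noteq> 0"
        unfolding 2(2) p_unit[OF 2(1)] by (subst sum_nonneg_eq_0_iff) auto
      then show ?thesis by blast
    qed
  qed
  then obtain l where l: "\<And>i. i \<in> I \<Longrightarrow> l i > 0"
    and gen: "\<And>h. h \<in> G \<Longrightarrow> \<exists>m. (\<forall>i\<in>I. m i = l i) \<and> h m \<noteq> 0" by blast
  have resp: "eval_pair f (p l x) (p l y) \<noteq> 0" if "f \<in> F" "(x, y) \<in> I" for f x y
  proof -
    have "(\<lambda>l. eval_pair f (p l x) (p l y)) \<in> G" unfolding G_def using that by force
    then obtain m where "\<forall>i\<in>I. m i = l i" "eval_pair f (p m x) (p m y) \<noteq> 0" using gen by blast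
    then show ?thesis using p_cong[of m l] by simp
  qed
  have inj: "p l x \<noteq> p l y" if "(x, y) \<in> I" for x y
  proof -
    have "(\<lambda>l. \<Sum>j\<in>UNIV. (p l x $ j - p l y $ j) ^ 2) \<in> G" unfolding G_def using that by force
    then obtain m where m: "\<forall>i\<in>I. m i = l i" "(\<Sum>j\<in>UNIV. (p m x $ j - p m y $ j) ^ 2) \<noteq> 0"
      using gen by blast
    from m(2) have "p m x \<noteq> p m y" by auto
    then show ?thesis using p_cong[OF m(1)] by simp
  qed
  have "homothetic_copy T (p l ` e ` A)" if e: "e \<in> E" for e
  proof -
    obtain a b where ab: "a \<in> A" "b \<in> A" "b \<noteq> a"
      using two_elements[OF A(2)] by metis
    \<comment> \<open>\<open>N\<close> collects the pairs whose coordinate moves along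
      \<open>e\<close>. Their weights add up to the ratio \<open>r\<close>, and the coordinates
      constant on \<open>e\<close> contribute the translation \<open>v\<close>. The coordinate
      separating \<open>e b\<close> from \<open>e a\<close> belongs to \<open>N\<close>, which makes
      \<open>r\<close> positive.\<close>
    define N where "N = {i \<in> I. \<forall>a\<in>A. \<phi> i (e a) = a}"
    define r where "r = (\<Sum>i\<in>N. l i)"
    define v where "v = (\<Sum>i\<in>I - N. l i *\<^sub>R \<tau> (\<phi> i (e a)))"
    have "e b \<noteq> e a" using D(3)[OF e] ab by (auto dest: inj_onD)
    then have ba: "(e b, e a) \<in> I" using D(4)[OF e] ab by (simp add: I_def)
    then have "(e b, e a) \<in> N"
      using \<phi>[OF ba] coordinateD(2)[OF _ e] ab unfolding N_def by fastforce
    moreover have "finite N" "N \<subseteq> I" using finI by (auto simp: N_def)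
    ultimately have r: "r > 0"
      unfolding r_def using l by (intro sum_pos) auto
    have "p l (e c) = v + r *\<^sub>R \<tau> c" if c: "c \<in> A" for c
    proof -
      have "p l (e c) = (\<Sum>i\<in>I - N. l i *\<^sub>R \<tau> (\<phi> i (e c))) + (\<Sum>i\<in>N. l i *\<^sub>R \<tau> (\<phi> i (e c)))"
        unfolding p_def using finI by (intro sum.subset_diff) (auto simp: N_def)
      also have "(\<Sum>i\<in>I - N. l i *\<^sub>R \<tau> (\<phi> i (e c))) = v"
        unfolding v_def
      proof (intro sum.cong refl)
        fix i assume i: "i \<in> I - N"
        have "\<phi> i (e c) = \<phi> i (e a)"
          using coordinateD(2)[OF _ e, of A V "\<phi> i"] \<phi>[of i] i c ab(1) unfolding N_def by fastforce
        then show "l i *\<^sub>R \<tau> (\<phi> i (e c)) = l i *\<^sub>R \<tau> (\<phi> i (e a))" by simp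
      qed
      also have "(\<Sum>i\<in>N. l i *\<^sub>R \<tau> (\<phi> i (e c))) = r *\<^sub>R \<tau> c"
        unfolding r_def scaleR_sum_left using c by (intro sum.cong) (auto simp: N_def)
      finally show ?thesis .
    qed
    then have "p l ` e ` A = (\<lambda>c. v + r *\<^sub>R \<tau> c) ` A"
      unfolding image_image by (intro image_cong refl)
    also have "\<dots> = (\<lambda>t. v + r *\<^sub>R t) ` T"
      using bij_betw_imp_surj_on[OF \<tau>] by blast
    finally have "p l ` e ` A = (\<lambda>t. v + r *\<^sub>R t) ` T" .
    then show ?thesis
      unfolding homothetic_copy_def homothetic_map_def using r by blast
  qed
  moreover have "inj_on (p l) V" using inj by (auto simp: inj_on_def I_def)
  moreover have "respects_set F (p l ` V)" using resp by (auto simp: respects_set_def I_def)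
  ultimately show ?thesis by blast
qed

theorem theorem4:
  fixes T :: "(real ^ 'd::finite) set"
    and F :: "('d + 'd) real_mpoly set"
    and g k :: nat
  assumes "finite T" and "card T \<ge> 3"
    and "countable F" and "respects_set F T"
    and "g > 0" and "k > 0"
  shows "\<exists>(X :: (real ^ 'd) set) \<T>.
    finite X \<and>
    (\<forall>S\<in>\<T>. homothetic_copy T S \<and> S \<subseteq> X) \<and>
    respects_set F X \<and>
    (\<forall>Ts. set Ts \<subseteq> \<T> \<and> length Ts < g \<longrightarrow> \<not> cycle_on X Ts) \<and>
    (\<forall>c :: real ^ 'd \<Rightarrow> nat. c ` X \<subseteq> {..<k} \<longrightarrow> (\<exists>S\<in>\<T>. monochromatic c S))"
proof -
  obtain A :: "nat set" and \<tau> where \<tau>: "bij_betw \<tau> A T" and "finite A"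
    using ex_bij_betw_nat_finite[OF assms(1)] by blast
  have A2: "card A \<ge> 2" using bij_betw_same_card[OF \<tau>] assms(2) by simp
  obtain V :: "nat set" and E where P: "partite_system A k g id UNIV V E"
    using sparse_Hales_Jewett[OF \<open>finite A\<close> A2 assms(6)] unfolding sparse_lines_def by blast
  note P' = partite_systemD[OF P]
  note D = line_systemD[OF P'(1)]
  obtain p where p: "inj_on p V" "respects_set F (p ` V)" "\<And>e. e \<in> E \<Longrightarrow> homothetic_copy T (p ` e ` A)"
    using line_system_realisation[OF P'(1) \<open>finite A\<close> A2 \<tau> assms(3,4)] by blast
  define \<T> where "\<T> = (\<lambda>e. p ` e ` A) ` E"
  \<comment> \<open>\<open>cycle_on\<close> deals with distinct sets, so the family indexed by lines
    is re-indexed by the sets themselves.\<close>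
  have sp: "sparse g (\<lambda>S. S) \<T>"
    by (rule sparse_image[OF P'(2) p(1), where h = "\<lambda>e. p ` e ` A"]) (use D(4) in \<open>auto simp: \<T>_def\<close>)
  have mono: "\<exists>S\<in>\<T>. monochromatic c S" if "c ` p ` V \<subseteq> {..<k}" for c :: "real ^ 'd \<Rightarrow> nat"
  proof -
    have "\<exists>e\<in>E. \<exists>q. \<forall>a\<in>A. (c \<circ> p) (e a) = q"
      using that by (intro P'(4)) auto
    then show ?thesis by (auto simp: \<T>_def monochromatic_def)
  qed
  show ?thesis
  proof (intro exI[of _ "p ` V"] exI[of _ \<T>] conjI)
    show "finite (p ` V)" using D(1) by simp
    show "\<forall>S\<in>\<T>. homothetic_copy T S \<and> S \<subseteq> p ` V" using p(3) D(4) by (auto simp: \<T>_def)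
    show "\<forall>Ts. set Ts \<subseteq> \<T> \<and> length Ts < g \<longrightarrow> \<not> cycle_on (p ` V) Ts"
      using sparse_imp_not_cycle[OF sp] by blast
  qed (use p(2) mono in blast)+
qed

end
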